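(* The transvection group $\hat G$ of the symmetric space $X$ is isomorphic to $\mathrm{Osc}_{2,0}(1,1)$. The identity component $G$ of the isometry group of $X$ is isomorphic to $\mathrm{Osc}_{2,0}(1,1)\rtimes\mathbb R$, where $s\in\mathbb R$ acts on $\mathrm{Osc}_{2,0}(1,1)$ by $$s.(z,\xi_1,\xi_2,t)=(z,e^{s\phi}(\xi_1,\xi_2),t),\qquad\phi(\xi_1,\xi_2)=(\xi_2,\xi_1).$$ These isomorphisms can be chosen compatibly (so that $\hat G\subset G$ corresponds to the factor $\mathrm{Osc}_{2,0}(1,1)$) and such that, under the resulting identifications, the stabilisers of the base point in $\hat G$ and $G$ equal, respectively, $$\hat G_+=\{(0,iy_1,iy_2,0)\mid y_1,y_2\in\mathbb R\}\quad\text{and}\quad G_+=\hat G_+\rtimes\mathbb R,$$ and such that the map $$\iota:Q\hookrightarrow G,\qquad(2z,2\xi,2t)\longmapsto(z,\xi,A\xi,t,t)$$ is a homomorphism whose image equals the group of left translations on $X$.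
   Context: Let $\omega(\xi,\xi')=xy'-x'y$ for $\xi=(x,y),\xi'=(x',y')\in\mathbb R^2$ and $A=\begin{pmatrix}0&1\\1&0\end{pmatrix}$. The split oscillator group $Q=\mathrm{Osc}_{1,0}$ is $\mathbb R\times\mathbb R^2\times\mathbb R$ with $(z,\xi,t)(z',\xi',t')=(z+z'+\tfrac12\omega(\xi,e^{tA}\xi'),\xi+e^{tA}\xi',t+t')$. Its Lie algebra, identified with $\mathbb R\oplus\mathbb R^2\oplus\mathbb R$, carries the ad-invariant inner product $\langle(Z,X,T),(Z',X',T')\rangle=\langle X,X'\rangle_0+ZT'+Z'T$ with $\langle\cdot,\cdot\rangle_0=\mathrm{diag}(-1,1)$, which defines a bi-invariant metric of signature $(2,2)$ on $Q$. The manifold $Q$ with this metric is a pseudo-Riemannian symmetric space, denoted $X$, with base point the identity element. The transvection group of a (connected) symmetric space is the subgroup of the isometry group generated by all compositions of two geodesic reflections. Identify $\mathbb R^2\cong\mathbb C$ (so $iy=(0,y)$ for $y\in\mathbb R$). Let $H_2=\mathbb R\times\mathbb C\times\mathbb C$ with $$(z,\xi_1,\xi_2)(\hat z,\hat\xi_1,\hat\xi_2)=\big(z+\hat z+\tfrac12(\omega(\xi_1,\hat\xi_1)-\omega(\xi_2,\hat\xi_2)),\ \xi_1+\hat\xi_1,\ \xi_2+\hat\xi_2\big),$$ and let $\mathrm{Osc}_{2,0}(1,1)=H_2\rtimes\mathbb R$, where $t\in\mathbb R$ acts by $t.(z,\xi_1,\xi_2)=(z,e^{tA}\xi_1,e^{tA}\xi_2)$;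 elements are written $(z,\xi_1,\xi_2,t)$. Elements of $\mathrm{Osc}_{2,0}(1,1)\rtimes\mathbb R$ are written $(z,\xi_1,\xi_2,t,s)$. *)

theory Defs
  imports
    "HOL-Analysis.Analysis"
    "HOL-Algebra.Generated_Groups"
    "HOL-Algebra.Group_Action"
begin

section \<open>Linear algebra of the plane\<close>

text \<open>
  Throughout, $(x,y) \in \mathbb{R}^2$ is identified with $x + iy \in \mathbb{C}$, so that the
  type \<^typ>\<open>complex\<close>, regarded as a real vector space, serves as the plane.
\<close>

text \<open>The exponential $e^F$ of a linear map, as a power series applied to a vector.\<close>

definition lin_exp :: "('a \<Rightarrow> 'a) \<Rightarrow> 'a \<Rightarrow> 'a::real_normed_vector" where
  "lin_exp F v = (\<Sum>n. (1 / fact n) *\<^sub>R (F ^^ n) v)"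

definition omega :: "complex \<Rightarrow> complex \<Rightarrow> real" where
  "omega \<xi> \<xi>' = Re \<xi> * Im \<xi>' - Re \<xi>' * Im \<xi>"

definition mat_A :: "complex \<Rightarrow> complex" where
  "mat_A \<xi> = Complex (Im \<xi>) (Re \<xi>)"

definition exp_tA :: "real \<Rightarrow> complex \<Rightarrow> complex" where
  "exp_tA t = lin_exp (\<lambda>\<xi>. t *\<^sub>R mat_A \<xi>)"

definition inner0 :: "complex \<Rightarrow> complex \<Rightarrow> real" where
  "inner0 X X' = - (Re X * Re X') + Im X * Im X'"

definition phi :: "complex \<times> complex \<Rightarrow> complex \<times> complex" where
  "phi = (\<lambda>(\<xi>1, \<xi>2). (\<xi>2, \<xi>1))"

definition exp_sphi :: "real \<Rightarrow> complex \<times> complex \<Rightarrow> complex \<times> complex" where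
  "exp_sphi s = lin_exp (\<lambda>w. s *\<^sub>R phi w)"

section \<open>The groups\<close>

type_synonym osc = "real \<times> complex \<times> real"

definition Q :: "osc monoid" where
  "Q = \<lparr>carrier = UNIV,
        mult = (\<lambda>(z, \<xi>, t) (z', \<xi>', t').
          (z + z' + 1/2 * omega \<xi> (exp_tA t \<xi>'), \<xi> + exp_tA t \<xi>', t + t')),
        one = (0, 0, 0)\<rparr>"

type_synonym heis2 = "real \<times> complex \<times> complex"

definition H2 :: "heis2 monoid" where
  "H2 = \<lparr>carrier = UNIV,
         mult = (\<lambda>(z, \<xi>1, \<xi>2) (z', \<xi>1', \<xi>2').
           (z + z' + 1/2 * (omega \<xi>1 \<xi>1' - omega \<xi>2 \<xi>2'), \<xi>1 + \<xi>1', \<xi>2 + \<xi>2')),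
         one = (0, 0, 0)\<rparr>"

text \<open>
  The semidirect product of a group with $(\mathbb{R},+)$, where \<open>a t\<close> is the automorphism by
  which $t \in \mathbb{R}$ acts.
\<close>

definition semidirect_real ::
    "'a monoid \<Rightarrow> (real \<Rightarrow> 'a \<Rightarrow> 'a) \<Rightarrow> ('a \<times> real) monoid" where
  "semidirect_real N a =
     \<lparr>carrier = carrier N \<times> UNIV,
      mult = (\<lambda>(n, t) (n', t'). (n \<otimes>\<^bsub>N\<^esub> a t n', t + t')),
      one = (\<one>\<^bsub>N\<^esub>, 0)\<rparr>"

text \<open>
  Elements $(z,\xi_1,\xi_2,t)$ of $\mathrm{Osc}_{2,0}(1,1)$ are encoded as
  \<open>((z, \<xi>1, \<xi>2), t)\<close>, and elements $(z,\xi_1,\xi_2,t,s)$ of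
  $\mathrm{Osc}_{2,0}(1,1) \rtimes \mathbb{R}$ as \<open>(((z, \<xi>1, \<xi>2), t), s)\<close>.
\<close>

definition Osc2 :: "(heis2 \<times> real) monoid" where
  "Osc2 = semidirect_real H2 (\<lambda>t (z, \<xi>1, \<xi>2). (z, exp_tA t \<xi>1, exp_tA t \<xi>2))"

definition s_action :: "real \<Rightarrow> heis2 \<times> real \<Rightarrow> heis2 \<times> real" where
  "s_action s = (\<lambda>((z, w), t). ((z, exp_sphi s w), t))"

definition Osc2_R :: "((heis2 \<times> real) \<times> real) monoid" where
  "Osc2_R = semidirect_real Osc2 s_action"

definition G_hat_plus :: "(heis2 \<times> real) set" where
  "G_hat_plus = {((0, \<i> * of_real y1, \<i> * of_real y2), 0) | y1 y2. True}"

text \<open>The map $(2z, 2\xi, 2t) \mapsto (z, \xi, A\xi, t, t)$.\<close>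

definition iota :: "osc \<Rightarrow> (heis2 \<times> real) \<times> real" where
  "iota = (\<lambda>(z, \<xi>, t). (((z / 2, \<xi> / 2, mat_A (\<xi> / 2)), t / 2), t / 2))"

section \<open>The pseudo-Riemannian manifold and its isometries\<close>

text \<open>
  The manifold is the vector space \<^typ>\<open>osc\<close>, which is a global chart, so each tangent space
  is again \<^typ>\<open>osc\<close>; the Lie algebra is the tangent space at $(0,0,0)$.
\<close>

definition lie_inner :: "osc \<Rightarrow> osc \<Rightarrow> real" where
  "lie_inner = (\<lambda>(Z, X, T) (Z', X', T'). inner0 X X' + Z * T' + Z' * T)"

definition left_translation :: "osc \<Rightarrow> osc \<Rightarrow> osc" where
  "left_translation q p = q \<otimes>\<^bsub>Q\<^esub> p"

text \<open>
  The left-invariant extension of \<^const>\<open>lie_inner\<close>: tangent vectors at \<open>q\<close> are moved to the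
  identity by the differential of the left translation by the inverse of \<open>q\<close>. It is
  bi-invariant because \<^const>\<open>lie_inner\<close> is ad-invariant.
\<close>

definition metric :: "osc \<Rightarrow> osc \<Rightarrow> osc \<Rightarrow> real" where
  "metric q v w =
     (let D = frechet_derivative (left_translation (inv\<^bsub>Q\<^esub> q)) (at q)
      in lie_inner (D v) (D w))"

primrec C_diff :: "nat \<Rightarrow> ('a::euclidean_space \<Rightarrow> 'b::real_normed_vector) \<Rightarrow> bool" where
  "C_diff 0 f \<longleftrightarrow> continuous_on UNIV f"
| "C_diff (Suc k) f \<longleftrightarrow>
     (\<forall>x. f differentiable (at x)) \<and>
     (\<forall>v. C_diff k (\<lambda>x. frechet_derivative f (at x) v))"

definition smooth :: "('a::euclidean_space \<Rightarrow> 'b::real_normed_vector) \<Rightarrow> bool" where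
  "smooth f \<longleftrightarrow> (\<forall>k. C_diff k f)"

definition isometries :: "(osc \<Rightarrow> osc) set" where
  "isometries =
     {f. bij f \<and> smooth f \<and> smooth (inv_into UNIV f) \<and>
         (\<forall>p v w. metric (f p) (frechet_derivative f (at p) v) (frechet_derivative f (at p) w)
                = metric p v w)}"

definition Isom :: "(osc \<Rightarrow> osc) monoid" where
  "Isom = \<lparr>carrier = isometries, mult = (\<circ>), one = id\<rparr>"

text \<open>
  The Lie group topology of the isometry group of a pseudo-Riemannian manifold is the
  compact-open topology.
\<close>

definition compact_open :: "('a::topological_space \<Rightarrow> 'b::topological_space) topology" where
  "compact_open = topology_generated_by {{f. f ` K \<subseteq> U} | K U. compact K \<and> open U}"

definition Isom_0 :: "(osc \<Rightarrow> osc) monoid" where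
  "Isom_0 = Isom\<lparr>carrier :=
     connected_component_of_set (subtopology compact_open isometries) id\<rparr>"

text \<open>
  The geodesic reflection at \<open>p\<close> is the isometry fixing \<open>p\<close> whose differential there is
  minus the identity.
\<close>

definition geodesic_reflection :: "osc \<Rightarrow> (osc \<Rightarrow> osc) \<Rightarrow> bool" where
  "geodesic_reflection p \<sigma> \<longleftrightarrow>
     \<sigma> \<in> isometries \<and> \<sigma> p = p \<and> (\<sigma> has_derivative (\<lambda>v. - v)) (at p)"

definition Transv :: "(osc \<Rightarrow> osc) monoid" where
  "Transv = Isom\<lparr>carrier := generate Isom
     {\<sigma> \<circ> \<tau> | \<sigma> \<tau>. (\<exists>p. geodesic_reflection p \<sigma>) \<and> (\<exists>q. geodesic_reflection q \<tau>)}\<rparr>"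

text \<open>
  Isomorphism of a Lie group, realised on a Euclidean space, with a group of isometries:
  a group isomorphism that is a homeomorphism. A homeomorphic isomorphism of Lie groups is
  automatically a diffeomorphism.
\<close>

definition lie_iso ::
    "('c::euclidean_space) monoid \<Rightarrow> (osc \<Rightarrow> osc) monoid \<Rightarrow> ('c \<Rightarrow> osc \<Rightarrow> osc) set" where
  "lie_iso L K =
     {\<Phi> \<in> iso L K.
        homeomorphic_map (top_of_set (carrier L)) (subtopology compact_open (carrier K)) \<Phi>}"

end

theory Submission
  imports Defs
begin

text \<open>
  The metric is bi-invariant, so $Q \times Q$ acts by isometries $x \mapsto g\,x\,\kappa(h)$,
  where $\kappa$ (\<open>flip\<close>) is the anti-automorphism
  $(z,\xi,t) \mapsto (z, e^{tA}\bar\xi, t)$, which turns right translations into a left action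
  (\<open>two_sided\<close>). The kernel of this action is the antidiagonal copy of the centre of $Q$, and
  the quotient by it is $\mathrm{Osc}_{2,0}(1,1) \rtimes \mathbb{R}$: the element
  $(z,\xi_1,\xi_2,t,s)$ is the class of the pairs whose plane components are
  $\xi_1 + A\xi_2$ and $\xi_1 - A\xi_2$, whose $t$-components are $t+s$ and $t-s$, and whose
  $z$-components add up to $2z$ (\<open>act\<close>, \<open>act_mult\<close>). In these terms
  $\mathrm{Osc}_{2,0}(1,1)$ consists of the pairs with equal $t$-components, and $\iota$ is the
  inclusion of the left factor.

  The main point is that the identity component contains no further isometries
  (\<open>isometry_translations\<close>, \<open>identity_component\<close>). Work in coordinates $p = y + x$,
  $q = y - x$ of the plane, in which $e^{tA}$ is diagonal. The metric coefficients are affine in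
  these coordinates, and the geodesics are the solutions of $t'' = 0$, $p'' = t'p'$,
  $q'' = -t'q'$ with one more equation for $z$. An isometry $f$ maps geodesics to geodesics, so the
  components $t \circ f$, $p \circ f$, $q \circ f$ satisfy linear equations along every geodesic.
  The straight lines in the slices $t = const$ and the geodesics with $t' = 1$ already force
  $t \circ f = ct + d$ with $c = \pm 1$ and $p \circ f = a(t) + m(t)p + n(t)q$ with explicit
  coefficients, and similarly for $q \circ f$ (\<open>coordinate_form\<close>, \<open>isometry_form\<close>); the
  component $z \circ f$ is then determined up to a constant by the metric. If $c$ and $m(0)$ are
  positive, the result is a two-sided translation. Exactly one of $m(0)$, $n(0)$ is nonzero, and
  $c$, $m(0)$, $n(0)$ are differences of coordinates of $f$ at fixed points; so the conditions
  $c > 0$ and $m(0) > 0$ define a set that is both open and closed in the compact-open topology.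

  The geodesic reflection at $p$ is $x \mapsto p\,x^{-1}p$, since by the classification an isometry
  with the 1-jet of the identity is the identity (\<open>geodesic_reflection_iff\<close>). A product of two
  reflections is $x \mapsto (pq^{-1})\,x\,(q^{-1}p)$, where both factors have the same
  $t$-component. Conversely, every map $x \mapsto g\,x\,h$ whose factors have the same
  $t$-component is a product of maps $x \mapsto a\,x\,a$ (\<open>balanced_two_sided_generated\<close>). Hence the transvection group is the
  part $s = 0$.

  Finally the group parameters depend continuously on the values of the isometry at three points
  (\<open>recover\<close>), which makes the isomorphisms homeomorphisms.
\<close>

section \<open>The exponentials\<close>

text \<open>On a sum of two eigenvectors the operator exponential reduces to scalar ones. This suffices
  because $A$ and $\phi$ are involutions, so that their eigenspaces span.\<close>

lemma lin_exp_eigen: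
  assumes "linear F" "F a = l *\<^sub>R a" "F b = m *\<^sub>R b"
  shows "lin_exp F (a + b) = exp l *\<^sub>R a + exp m *\<^sub>R b"
proof -
  have pow: "(F ^^ n) (a + b) = l ^ n *\<^sub>R a + m ^ n *\<^sub>R b" for n
  proof (induction n)
    case (Suc n)
    then show ?case
      using assms by (simp add: linear_add linear_scale mult.commute)
  qed simp
  have e: "(\<lambda>n. (k ^ n /\<^sub>R fact n) *\<^sub>R v) sums (exp k *\<^sub>R v)" for k and v :: 'a
    by (rule bounded_linear.sums[OF bounded_linear_scaleR_left exp_converges])
  have "(\<lambda>n. (1 / fact n) *\<^sub>R (F ^^ n) (a + b)) sums (exp l *\<^sub>R a + exp m *\<^sub>R b)"
    using sums_add[OF e[of l a] e[of m b]]
    by (simp add: pow scaleR_add_right divide_inverse mult.commute)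
  then show ?thesis
    unfolding lin_exp_def by (rule sums_unique[symmetric])
qed

lemma exp_tA_eq:
  "exp_tA t \<xi> = Complex (cosh t * Re \<xi> + sinh t * Im \<xi>) (sinh t * Re \<xi> + cosh t * Im \<xi>)"
proof -
  define a where "a = Complex ((Im \<xi> + Re \<xi>) / 2) ((Im \<xi> + Re \<xi>) / 2)"
  define b where "b = Complex ((Re \<xi> - Im \<xi>) / 2) ((Im \<xi> - Re \<xi>) / 2)"
  have "lin_exp (\<lambda>\<xi>. t *\<^sub>R mat_A \<xi>) (a + b) = exp t *\<^sub>R a + exp (- t) *\<^sub>R b"
    by (rule lin_exp_eigen)
      (auto intro!: linearI simp: mat_A_def a_def b_def complex_eq_iff algebra_simps diff_divide_distrib)
  moreover have "a + b = \<xi>"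
    by (simp add: a_def b_def complex_eq_iff field_simps)
  ultimately have "exp_tA t \<xi> = exp t *\<^sub>R a + exp (- t) *\<^sub>R b"
    by (simp only: exp_tA_def)
  then show ?thesis
    by (simp add: a_def b_def complex_eq_iff cosh_def sinh_def field_simps)
qed

lemma exp_sphi_eq:
  "exp_sphi s (\<xi>, \<eta>) = (cosh s *\<^sub>R \<xi> + sinh s *\<^sub>R \<eta>, sinh s *\<^sub>R \<xi> + cosh s *\<^sub>R \<eta>)"
proof -
  define a where "a = ((1/2) *\<^sub>R (\<xi> + \<eta>), (1/2) *\<^sub>R (\<xi> + \<eta>))"
  define b where "b = ((1/2) *\<^sub>R (\<xi> - \<eta>), (1/2) *\<^sub>R (\<eta> - \<xi>))"
  have "lin_exp (\<lambda>w. s *\<^sub>R phi w) (a + b) = exp s *\<^sub>R a + exp (- s) *\<^sub>R b"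
    by (rule lin_exp_eigen)
      (auto intro!: linearI simp: phi_def a_def b_def complex_eq_iff algebra_simps split: prod.splits)
  moreover have "a + b = (\<xi>, \<eta>)"
    by (simp add: a_def b_def complex_eq_iff field_simps)
  ultimately have "exp_sphi s (\<xi>, \<eta>) = exp s *\<^sub>R a + exp (- s) *\<^sub>R b"
    by (simp only: exp_sphi_def)
  then show ?thesis
    by (simp add: a_def b_def complex_eq_iff cosh_def sinh_def field_simps)
qed

section \<open>Null coordinates\<close>

text \<open>The components of the plane along the eigenvectors of $A$: $e^{tA}$ multiplies \<open>pc\<close> by $e^t$
  and \<open>qc\<close> by $e^{-t}$. Both directions are null, as $\langle\xi,\xi\rangle_0$ is the product
  of the two.\<close>

definition zc :: "osc \<Rightarrow> real" where "zc x = fst x"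
definition pc :: "osc \<Rightarrow> real" where "pc x = Im (fst (snd x)) + Re (fst (snd x))"
definition qc :: "osc \<Rightarrow> real" where "qc x = Im (fst (snd x)) - Re (fst (snd x))"
definition tc :: "osc \<Rightarrow> real" where "tc x = snd (snd x)"

definition of_null :: "real \<Rightarrow> real \<Rightarrow> real \<Rightarrow> real \<Rightarrow> osc" where
  "of_null z p q t = (z, Complex ((p - q) / 2) ((p + q) / 2), t)"

lemmas null_defs = zc_def pc_def qc_def tc_def

lemma null_of_null [simp]:
  "zc (of_null z p q t) = z" "pc (of_null z p q t) = p"
  "qc (of_null z p q t) = q" "tc (of_null z p q t) = t"
  by (simp_all add: of_null_def null_defs field_simps)

lemma null_eqI: "zc x = zc y \<Longrightarrow> pc x = pc y \<Longrightarrow> qc x = qc y \<Longrightarrow> tc x = tc y \<Longrightarrow> x = y"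
  by (auto simp: null_defs prod_eq_iff complex_eq_iff)

lemma of_null_coords [simp]: "of_null (zc x) (pc x) (qc x) (tc x) = x"
  by (rule null_eqI) simp_all

lemma bounded_linear_null:
  "bounded_linear zc" "bounded_linear pc" "bounded_linear qc" "bounded_linear tc"
  unfolding zc_def[abs_def] pc_def[abs_def] qc_def[abs_def] tc_def[abs_def]
  by (intro bounded_linear_fst bounded_linear_add bounded_linear_sub
      bounded_linear_compose[OF bounded_linear_Im] bounded_linear_compose[OF bounded_linear_Re]
      bounded_linear_compose[OF bounded_linear_fst] bounded_linear_compose[OF bounded_linear_snd]
      bounded_linear_snd)+

lemma null_linear [simp]:
  "zc (x + y) = zc x + zc y" "pc (x + y) = pc x + pc y"
  "qc (x + y) = qc x + qc y" "tc (x + y) = tc x + tc y"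
  "zc (x - y) = zc x - zc y" "pc (x - y) = pc x - pc y"
  "qc (x - y) = qc x - qc y" "tc (x - y) = tc x - tc y"
  "zc (- x) = - zc x" "pc (- x) = - pc x" "qc (- x) = - qc x" "tc (- x) = - tc x"
  "zc (r *\<^sub>R x) = r * zc x" "pc (r *\<^sub>R x) = r * pc x"
  "qc (r *\<^sub>R x) = r * qc x" "tc (r *\<^sub>R x) = r * tc x"
  "zc 0 = 0" "pc 0 = 0" "qc 0 = 0" "tc 0 = 0"
  by (simp_all add: null_defs algebra_simps)

lemma null_one [simp]: "zc \<one>\<^bsub>Q\<^esub> = 0" "pc \<one>\<^bsub>Q\<^esub> = 0" "qc \<one>\<^bsub>Q\<^esub> = 0" "tc \<one>\<^bsub>Q\<^esub> = 0"
  by (simp_all add: Q_def null_defs)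

lemma carrier_Q [simp]: "carrier Q = UNIV"
  by (simp add: Q_def)

lemma one_Q: "\<one>\<^bsub>Q\<^esub> = 0"
  by (rule null_eqI) simp_all

lemma null_mult [simp]:
  "zc (x \<otimes>\<^bsub>Q\<^esub> y) = zc x + zc y + (pc x * exp (- tc x) * qc y - qc x * exp (tc x) * pc y) / 4"
  "pc (x \<otimes>\<^bsub>Q\<^esub> y) = pc x + exp (tc x) * pc y"
  "qc (x \<otimes>\<^bsub>Q\<^esub> y) = qc x + exp (- tc x) * qc y"
  "tc (x \<otimes>\<^bsub>Q\<^esub> y) = tc x + tc y"
  by (cases x; cases y;
      simp add: Q_def null_defs exp_tA_eq omega_def cosh_def sinh_def field_simps)+

lemma group_Q: "group Q"
proof (rule groupI)
  fix x
  define y where "y = of_null (- zc x) (- exp (- tc x) * pc x) (- exp (tc x) * qc x) (- tc x)"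
  have "y \<otimes>\<^bsub>Q\<^esub> x = \<one>\<^bsub>Q\<^esub>"
    by (rule null_eqI) (simp_all add: y_def algebra_simps exp_minus)
  then show "\<exists>y\<in>carrier Q. y \<otimes>\<^bsub>Q\<^esub> x = \<one>\<^bsub>Q\<^esub>"
    by (intro bexI[of _ y]) simp_all
next
  show "x \<otimes>\<^bsub>Q\<^esub> y \<otimes>\<^bsub>Q\<^esub> z = x \<otimes>\<^bsub>Q\<^esub> (y \<otimes>\<^bsub>Q\<^esub> z)" for x y z
    by (rule null_eqI) (simp_all add: exp_add exp_minus exp_diff field_simps)
  show "\<one>\<^bsub>Q\<^esub> \<otimes>\<^bsub>Q\<^esub> x = x" for x
    by (rule null_eqI) simp_all
qed simp_all

interpretation Q: group Q
  by (rule group_Q)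

lemma null_inv [simp]:
  "zc (inv\<^bsub>Q\<^esub> x) = - zc x" "pc (inv\<^bsub>Q\<^esub> x) = - exp (- tc x) * pc x"
  "qc (inv\<^bsub>Q\<^esub> x) = - exp (tc x) * qc x" "tc (inv\<^bsub>Q\<^esub> x) = - tc x"
proof -
  define y where "y = of_null (- zc x) (- exp (- tc x) * pc x) (- exp (tc x) * qc x) (- tc x)"
  have "y \<otimes>\<^bsub>Q\<^esub> x = \<one>\<^bsub>Q\<^esub>"
    by (rule null_eqI) (simp_all add: y_def algebra_simps exp_minus)
  then have "inv\<^bsub>Q\<^esub> x = y"
    by (intro Q.inv_equality) auto
  then show "zc (inv\<^bsub>Q\<^esub> x) = - zc x" "pc (inv\<^bsub>Q\<^esub> x) = - exp (- tc x) * pc x"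
    "qc (inv\<^bsub>Q\<^esub> x) = - exp (tc x) * qc x" "tc (inv\<^bsub>Q\<^esub> x) = - tc x"
    by (simp_all add: y_def)
qed

section \<open>The metric in null coordinates\<close>

lemma of_null_eq: "of_null z p q t =
  z *\<^sub>R of_null 1 0 0 0 + p *\<^sub>R of_null 0 1 0 0 + q *\<^sub>R of_null 0 0 1 0 + t *\<^sub>R of_null 0 0 0 1"
  by (rule null_eqI) simp_all

lemma has_derivative_of_null [derivative_intros]:
  assumes "(z has_derivative z') F" "(p has_derivative p') F"
    "(q has_derivative q') F" "(t has_derivative t') F"
  shows "((\<lambda>x. of_null (z x) (p x) (q x) (t x)) has_derivative
    (\<lambda>x. of_null (z' x) (p' x) (q' x) (t' x))) F"
  by (subst (1 2) of_null_eq) (intro derivative_intros assms)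

lemmas has_derivative_null [derivative_intros] =
  bounded_linear_null[THEN bounded_linear.has_derivative]

lemma left_translation_eq: "left_translation g =
  (\<lambda>x. of_null (zc g + zc x + (pc g * exp (- tc g) * qc x - qc g * exp (tc g) * pc x) / 4)
    (pc g + exp (tc g) * pc x) (qc g + exp (- tc g) * qc x) (tc g + tc x))"
  by (rule ext, rule null_eqI) (simp_all add: left_translation_def)

lemma has_derivative_left_translation: "(left_translation g has_derivative
  (\<lambda>v. of_null (zc v + (pc g * exp (- tc g) * qc v - qc g * exp (tc g) * pc v) / 4)
    (exp (tc g) * pc v) (exp (- tc g) * qc v) (tc v))) (at x)"
  unfolding left_translation_eq
  by (auto intro!: derivative_eq_intros ext arg_cong[of _ _ "\<lambda>z. of_null z _ _ _"])

lemma lie_inner_eq: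
  "lie_inner v w = (pc v * qc w + qc v * pc w) / 2 + zc v * tc w + zc w * tc v"
  by (cases v; cases w) (simp add: lie_inner_def inner0_def null_defs field_simps)

text \<open>The factor $e^{-tA}$ in the differential of the left translation preserves
  $\langle\cdot,\cdot\rangle_0$, so that only the shear of the $z$-component by $\omega$ is visible.
  This is why the coefficients are affine in the base point.\<close>

lemma metric_eq: "metric x v w =
  (pc v * qc w + qc v * pc w) / 2 + zc v * tc w + zc w * tc v
  - ((pc x * qc v - qc x * pc v) * tc w + (pc x * qc w - qc x * pc w) * tc v) / 4"
  unfolding metric_def Let_def frechet_derivative_at[OF has_derivative_left_translation, symmetric]
    lie_inner_eq
  by (simp add: field_simps exp_minus)

section \<open>Smooth maps\<close>

abbreviation D :: "('a::euclidean_space \<Rightarrow> 'b::real_normed_vector) \<Rightarrow> 'a \<Rightarrow> 'a \<Rightarrow> 'b" where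
  "D f x \<equiv> frechet_derivative f (at x)"

lemma linear_eq_sum_Basis:
  fixes L :: "'a::euclidean_space \<Rightarrow> 'b::real_vector"
  assumes "linear L"
  shows "L v = (\<Sum>b\<in>Basis. (v \<bullet> b) *\<^sub>R L b)"
proof -
  have "L v = L (\<Sum>b\<in>Basis. (v \<bullet> b) *\<^sub>R b)"
    by (simp only: euclidean_representation)
  also have "\<dots> = (\<Sum>b\<in>Basis. (v \<bullet> b) *\<^sub>R L b)"
    by (simp add: linear_sum[OF assms] linear_scale[OF assms])
  finally show ?thesis .
qed

lemma C_diff_Suc_I:
  assumes "\<And>x. (f has_derivative f' x) (at x)" "\<And>v. C_diff k (\<lambda>x. f' x v)"
  shows "C_diff (Suc k) f"
proof -
  have "D f x = f' x" for x
    using assms(1) frechet_derivative_at by metis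
  then show ?thesis
    using assms by (auto simp: differentiable_def)
qed

lemma C_diff_Suc_D:
  assumes "C_diff (Suc k) f"
  shows "(f has_derivative D f x) (at x)" "C_diff k (\<lambda>x. D f x v)"
  using assms by (simp_all add: frechet_derivative_works)

lemma C_diff_Suc_imp: "C_diff (Suc k) f \<Longrightarrow> C_diff k f"
proof (induction k arbitrary: f)
  case 0
  then have "f differentiable_on UNIV"
    by (auto simp: differentiable_on_def)
  then show ?case
    by (simp add: differentiable_imp_continuous_on)
next
  case (Suc k)
  then show ?case
    by (metis C_diff.simps(2))
qed

lemma C_diff_const: "C_diff k (\<lambda>x. c)"
proof (induction k arbitrary: c)
  case (Suc k)
  show ?case
    by (rule C_diff_Suc_I[OF has_derivative_const Suc])
qed simp

lemma C_diff_bounded_linear: "bounded_linear h \<Longrightarrow> C_diff k h"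
proof (induction k)
  case (Suc k)
  show ?case
    by (rule C_diff_Suc_I[OF bounded_linear.has_derivative[OF Suc.prems has_derivative_ident]
          C_diff_const])
qed (simp add: linear_continuous_on)

lemma C_diff_bounded_linear_compose:
  assumes h: "bounded_linear h"
  shows "C_diff k f \<Longrightarrow> C_diff k (\<lambda>x. h (f x))"
proof (induction k arbitrary: f)
  case 0
  then show ?case
    by (auto intro: bounded_linear.continuous_on[OF h])
next
  case (Suc k)
  show ?case
    by (rule C_diff_Suc_I[OF bounded_linear.has_derivative[OF h C_diff_Suc_D(1)[OF Suc.prems]]])
      (intro Suc.IH C_diff_Suc_D(2)[OF Suc.prems])
qed

lemma C_diff_add: "C_diff k f \<Longrightarrow> C_diff k g \<Longrightarrow> C_diff k (\<lambda>x. f x + g x)"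
proof (induction k arbitrary: f g)
  case (Suc k)
  show ?case
    by (rule C_diff_Suc_I[OF has_derivative_add[OF C_diff_Suc_D(1)[OF Suc.prems(1)]
            C_diff_Suc_D(1)[OF Suc.prems(2)]]])
      (intro Suc.IH C_diff_Suc_D(2)[OF Suc.prems(1)] C_diff_Suc_D(2)[OF Suc.prems(2)])
qed (auto intro: continuous_intros)

lemma C_diff_scaleR:
  fixes f :: "'a::euclidean_space \<Rightarrow> real"
  shows "C_diff k f \<Longrightarrow> C_diff k g \<Longrightarrow> C_diff k (\<lambda>x. f x *\<^sub>R g x)"
proof (induction k arbitrary: f g)
  case (Suc k)
  show ?case
    by (rule C_diff_Suc_I[OF has_derivative_scaleR[OF C_diff_Suc_D(1)[OF Suc.prems(1)]
            C_diff_Suc_D(1)[OF Suc.prems(2)]]])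
      (intro C_diff_add Suc.IH C_diff_Suc_D(2)[OF Suc.prems(1)] C_diff_Suc_D(2)[OF Suc.prems(2)]
        C_diff_Suc_imp[OF Suc.prems(1)] C_diff_Suc_imp[OF Suc.prems(2)])
qed (auto intro: continuous_intros)

lemma C_diff_sum:
  "finite S \<Longrightarrow> (\<And>i. i \<in> S \<Longrightarrow> C_diff k (f i)) \<Longrightarrow> C_diff k (\<lambda>x. \<Sum>i\<in>S. f i x)"
  by (induction S rule: finite_induct) (auto intro: C_diff_add C_diff_const)

lemma C_diff_compose:
  fixes g :: "'a::euclidean_space \<Rightarrow> 'b::euclidean_space"
  shows "C_diff k f \<Longrightarrow> C_diff k g \<Longrightarrow> C_diff k (\<lambda>x. f (g x))"
proof (induction k arbitrary: f g)
  case 0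
  then show ?case
    by (auto intro: continuous_on_compose2)
next
  case (Suc k)
  note f = C_diff_Suc_D(1)[OF Suc.prems(1)] and g = C_diff_Suc_D(1)[OF Suc.prems(2)]
  \<comment> \<open>Expanding the inner derivative in a basis leaves only derivatives of \<open>f\<close> in fixed
    directions, to which the induction hypothesis applies.\<close>
  have expand: "D f (g x) (D g x v) = (\<Sum>b\<in>Basis. (D g x v \<bullet> b) *\<^sub>R D f (g x) b)" for x v
    by (rule linear_eq_sum_Basis[OF has_derivative_linear[OF f]])
  show ?case
  proof (rule C_diff_Suc_I[OF has_derivative_compose[OF g f]], unfold expand,
      intro C_diff_sum C_diff_scaleR finite_Basis)
    fix v b
    show "C_diff k (\<lambda>x. D f (g x) b)"
      by (rule Suc.IH[OF C_diff_Suc_D(2)[OF Suc.prems(1)] C_diff_Suc_imp[OF Suc.prems(2)]])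
    show "C_diff k (\<lambda>x. D g x v \<bullet> b)"
      by (rule C_diff_bounded_linear_compose[OF bounded_linear_inner_left
            C_diff_Suc_D(2)[OF Suc.prems(2)]])
  qed
qed

lemma C_diff_exp: "C_diff k (exp :: real \<Rightarrow> real)"
proof (induction k)
  case (Suc k)
  have "(exp has_derivative (\<lambda>v. exp x *\<^sub>R v)) (at x)" for x :: real
    by (auto intro!: derivative_eq_intros)
  then show ?case
    by (rule C_diff_Suc_I) (rule C_diff_scaleR[OF Suc C_diff_const])
qed (simp add: continuous_on_exp)

lemma smooth_const: "smooth (\<lambda>x. c)"
  by (simp add: smooth_def C_diff_const)

lemma smooth_bounded_linear: "bounded_linear h \<Longrightarrow> smooth h"
  by (simp add: smooth_def C_diff_bounded_linear)

lemma smooth_add: "smooth f \<Longrightarrow> smooth g \<Longrightarrow> smooth (\<lambda>x. f x + g x)"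
  by (simp add: smooth_def C_diff_add)

lemma smooth_scaleR:
  fixes f :: "'a::euclidean_space \<Rightarrow> real"
  shows "smooth f \<Longrightarrow> smooth g \<Longrightarrow> smooth (\<lambda>x. f x *\<^sub>R g x)"
  by (simp add: smooth_def C_diff_scaleR)

lemma smooth_compose:
  fixes g :: "'a::euclidean_space \<Rightarrow> 'b::euclidean_space"
  shows "smooth f \<Longrightarrow> smooth g \<Longrightarrow> smooth (\<lambda>x. f (g x))"
  by (simp add: smooth_def C_diff_compose)

lemma smooth_has_derivative: "smooth f \<Longrightarrow> (f has_derivative D f x) (at x)"
  unfolding smooth_def using C_diff_Suc_D(1) by blast

lemma smooth_D: "smooth f \<Longrightarrow> smooth (\<lambda>x. D f x v)"
  unfolding smooth_def using C_diff_Suc_D(2) by blast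

lemma smooth_continuous_on: "smooth f \<Longrightarrow> continuous_on S f"
  unfolding smooth_def using C_diff.simps(1) continuous_on_subset by blast

lemma smooth_mult:
  fixes f g :: "'a::euclidean_space \<Rightarrow> real"
  shows "smooth f \<Longrightarrow> smooth g \<Longrightarrow> smooth (\<lambda>x. f x * g x)"
  using smooth_scaleR[of f g] by simp

lemma smooth_minus:
  fixes f :: "'a::euclidean_space \<Rightarrow> real"
  shows "smooth f \<Longrightarrow> smooth (\<lambda>x. - f x)"
  using smooth_mult[OF smooth_const[of "-1"], of f] by simp

lemma smooth_diff:
  fixes f g :: "'a::euclidean_space \<Rightarrow> real"
  shows "smooth f \<Longrightarrow> smooth g \<Longrightarrow> smooth (\<lambda>x. f x - g x)"
  using smooth_add[OF _ smooth_minus, of f g] by simp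

lemma smooth_divide_const:
  fixes f :: "'a::euclidean_space \<Rightarrow> real"
  shows "smooth f \<Longrightarrow> smooth (\<lambda>x. f x / c)"
  using smooth_mult[OF _ smooth_const, of f "inverse c"] by (simp add: divide_inverse)

lemma smooth_exp: "smooth f \<Longrightarrow> smooth (\<lambda>x. exp (f x) :: real)"
  using smooth_compose[of exp f] by (simp add: smooth_def C_diff_exp)

lemma smooth_of_null:
  fixes z p q t :: "'a::euclidean_space \<Rightarrow> real"
  shows "smooth z \<Longrightarrow> smooth p \<Longrightarrow> smooth q \<Longrightarrow> smooth t \<Longrightarrow>
    smooth (\<lambda>x. of_null (z x) (p x) (q x) (t x))"
  by (subst of_null_eq) (intro smooth_add smooth_scaleR smooth_const)

lemmas smooth_intros = smooth_const smooth_add smooth_diff smooth_minus smooth_mult smooth_exp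
  smooth_divide_const smooth_of_null bounded_linear_null[THEN smooth_bounded_linear]

text \<open>The second difference is symmetric in \<open>u\<close> and \<open>v\<close>, whereas the mean value theorem,
  applied first along \<open>u\<close> and then along \<open>v\<close>, expresses it by one of the two mixed derivatives.
  Letting \<open>h\<close> tend to 0 in both orders shows that these agree.\<close>

lemma second_difference:
  fixes f :: "'a::real_normed_vector \<Rightarrow> real"
  assumes f: "\<And>x. (f has_derivative f' x) (at x)"
    and f': "\<And>x. ((\<lambda>x. f' x u) has_derivative f'' x) (at x)"
    and h: "h > 0"
  shows "\<exists>s t. 0 < s \<and> s < h \<and> 0 < t \<and> t < h \<and>
    f (x + h *\<^sub>R u + h *\<^sub>R v) - f (x + h *\<^sub>R u) - f (x + h *\<^sub>R v) + f x
      = h * h * f'' (x + s *\<^sub>R u + t *\<^sub>R v) v"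
proof -
  have lin: "linear (f' y)" "linear (f'' y)" for y
    using f f' has_derivative_linear by blast+
  have d1: "((\<lambda>s. f (y + s *\<^sub>R u)) has_real_derivative f' (y + s *\<^sub>R u) u) (at s)" for y s
  proof -
    have "((\<lambda>s. f (y + s *\<^sub>R u)) has_derivative (\<lambda>k. f' (y + s *\<^sub>R u) (k *\<^sub>R u))) (at s)"
      by (rule has_derivative_compose[OF _ f]) (auto intro!: derivative_eq_intros)
    then show ?thesis
      by (simp add: has_field_derivative_def linear_scale[OF lin(1)] mult.commute[of _ "f' _ _"])
  qed
  have d2: "((\<lambda>t. f' (y + t *\<^sub>R v) u) has_real_derivative f'' (y + t *\<^sub>R v) v) (at t)" for y t
  proof -
    have "((\<lambda>t. f' (y + t *\<^sub>R v) u) has_derivative (\<lambda>k. f'' (y + t *\<^sub>R v) (k *\<^sub>R v))) (at t)"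
      by (rule has_derivative_compose[OF _ f']) (auto intro!: derivative_eq_intros)
    then show ?thesis
      by (simp add: has_field_derivative_def linear_scale[OF lin(2)] mult.commute[of _ "f'' _ _"])
  qed
  define F where "F s = f ((x + h *\<^sub>R v) + s *\<^sub>R u) - f (x + s *\<^sub>R u)" for s
  have "(F has_real_derivative f' ((x + h *\<^sub>R v) + s *\<^sub>R u) u - f' (x + s *\<^sub>R u) u) (at s)" for s
    unfolding F_def by (intro DERIV_diff d1)
  from MVT2[OF h this] obtain s where s: "0 < s" "s < h"
    "F h - F 0 = h * (f' ((x + h *\<^sub>R v) + s *\<^sub>R u) u - f' (x + s *\<^sub>R u) u)"
    by auto
  obtain t where t: "0 < t" "t < h"
    "f' (x + s *\<^sub>R u + h *\<^sub>R v) u - f' (x + s *\<^sub>R u + 0 *\<^sub>R v) u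
      = h * f'' (x + s *\<^sub>R u + t *\<^sub>R v) v"
    using MVT2[OF h d2, of "x + s *\<^sub>R u"] by auto
  show ?thesis
    using s t by (intro exI[of _ s] exI[of _ t]) (simp add: F_def algebra_simps)
qed

lemma mixed_derivatives_commute_real:
  fixes f :: "'a::euclidean_space \<Rightarrow> real"
  assumes "smooth f"
  shows "D (\<lambda>x. D f x u) x v = D (\<lambda>x. D f x v) x u"
proof (rule ccontr)
  define A B where "A y = D (\<lambda>x. D f x u) y v" and "B y = D (\<lambda>x. D f x v) y u" for y
  assume "D (\<lambda>x. D f x u) x v \<noteq> D (\<lambda>x. D f x v) x u"
  then have e: "\<bar>A x - B x\<bar> / 2 > 0"
    by (simp add: A_def B_def)
  have "smooth A" "smooth B"
    unfolding A_def B_def by (intro smooth_D assms)+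
  then have "continuous_on UNIV A" "continuous_on UNIV B"
    by (auto intro: smooth_continuous_on)
  then obtain d1 d2 where d: "d1 > 0" "d2 > 0"
    "\<And>y. dist y x < d1 \<Longrightarrow> dist (A y) (A x) < \<bar>A x - B x\<bar> / 2"
    "\<And>y. dist y x < d2 \<Longrightarrow> dist (B y) (B x) < \<bar>A x - B x\<bar> / 2"
    using e unfolding continuous_on_iff by (metis UNIV_I)
  define h where "h = min d1 d2 / (norm u + norm v + 1)"
  have nn: "norm u + norm v + 1 > 0"
    by (smt (verit) norm_ge_zero)
  then have h: "h > 0"
    using d by (simp add: h_def)
  have close: "dist (x + s *\<^sub>R u + t *\<^sub>R v) x < min d1 d2"
    if "0 < s" "s < h" "0 < t" "t < h" for s t
  proof -
    have "dist (x + s *\<^sub>R u + t *\<^sub>R v) x = norm (s *\<^sub>R u + t *\<^sub>R v)"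
      by (simp add: dist_norm)
    also have "\<dots> \<le> s * norm u + t * norm v"
      using that norm_triangle_ineq[of "s *\<^sub>R u" "t *\<^sub>R v"] by simp
    also have "\<dots> \<le> h * norm u + h * norm v"
      using that by (intro add_mono mult_right_mono) auto
    also have "\<dots> < h * (norm u + norm v + 1)"
      using h by (simp add: algebra_simps)
    also have "\<dots> = min d1 d2"
      using nn by (simp add: h_def)
    finally show ?thesis .
  qed
  obtain s t where st: "0 < s" "s < h" "0 < t" "t < h"
    "f (x + h *\<^sub>R u + h *\<^sub>R v) - f (x + h *\<^sub>R u) - f (x + h *\<^sub>R v) + f x
      = h * h * A (x + s *\<^sub>R u + t *\<^sub>R v)"
    using second_difference[OF smooth_has_derivative[OF assms]
        smooth_has_derivative[OF smooth_D[OF assms]] h, of x u v]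
    unfolding A_def by blast
  obtain s' t' where st': "0 < s'" "s' < h" "0 < t'" "t' < h"
    "f (x + h *\<^sub>R v + h *\<^sub>R u) - f (x + h *\<^sub>R v) - f (x + h *\<^sub>R u) + f x
      = h * h * B (x + s' *\<^sub>R v + t' *\<^sub>R u)"
    using second_difference[OF smooth_has_derivative[OF assms]
        smooth_has_derivative[OF smooth_D[OF assms]] h, of x v u]
    unfolding B_def by blast
  have "f (x + h *\<^sub>R v + h *\<^sub>R u) = f (x + h *\<^sub>R u + h *\<^sub>R v)"
    by (simp add: algebra_simps)
  then have "h * h * A (x + s *\<^sub>R u + t *\<^sub>R v) = h * h * B (x + s' *\<^sub>R v + t' *\<^sub>R u)"
    using st(5) st'(5) by linarith
  then have "A (x + s *\<^sub>R u + t *\<^sub>R v) = B (x + t' *\<^sub>R u + s' *\<^sub>R v)"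
    using h by (simp add: algebra_simps)
  then show False
    using d(3)[of "x + s *\<^sub>R u + t *\<^sub>R v"] d(4)[of "x + t' *\<^sub>R u + s' *\<^sub>R v"]
      close[OF st(1-4)] close[OF st'(3,4,1,2)] e
    unfolding dist_real_def by (smt (verit) field_sum_of_halves)
qed

lemma D_bounded_linear_compose:
  assumes "bounded_linear h" "smooth f"
  shows "D (\<lambda>x. h (f x)) x v = h (D f x v)"
  using frechet_derivative_at[OF bounded_linear.has_derivative[OF assms(1)
        smooth_has_derivative[OF assms(2)]]] by metis

lemma mixed_derivatives_commute:
  fixes f :: "'a::euclidean_space \<Rightarrow> 'b::euclidean_space"
  assumes "smooth f"
  shows "D (\<lambda>x. D f x u) x v = D (\<lambda>x. D f x v) x u"
proof (rule euclidean_eqI)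
  fix b :: 'b
  have "smooth (\<lambda>x. f x \<bullet> b)"
    using assms unfolding smooth_def
    by (blast intro: C_diff_bounded_linear_compose[OF bounded_linear_inner_left])
  then show "D (\<lambda>x. D f x u) x v \<bullet> b = D (\<lambda>x. D f x v) x u \<bullet> b"
    using mixed_derivatives_commute_real[of "\<lambda>x. f x \<bullet> b" u x v]
    by (simp add: D_bounded_linear_compose[OF bounded_linear_inner_left] smooth_D assms)
qed

section \<open>The isometry group\<close>

lemma smooth_isometry: "f \<in> isometries \<Longrightarrow> smooth f"
  by (simp add: isometries_def)

lemma D_compose:
  "smooth f \<Longrightarrow> smooth g \<Longrightarrow> D (f \<circ> g) x v = D f (g x) (D g x v)"
  using frechet_derivative_at[OF diff_chain_at[OF smooth_has_derivative smooth_has_derivative], of g f x]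
  by (metis comp_apply)

lemma isometriesI:
  assumes "smooth f" "smooth g" "\<And>x. f (g x) = x" "\<And>x. g (f x) = x"
    and "\<And>x. (f has_derivative f' x) (at x)"
    and "\<And>x v w. metric (f x) (f' x v) (f' x w) = metric x v w"
  shows "f \<in> isometries"
proof -
  have "inv_into UNIV f = g"
    using assms(3,4) by (metis inv_equality)
  moreover have "bij f"
    using assms(3,4) by (metis bijI')
  moreover have "D f x = f' x" for x
    using assms(5) frechet_derivative_at by metis
  ultimately show ?thesis
    using assms by (simp add: isometries_def)
qed

lemma isometry_metric: "f \<in> isometries \<Longrightarrow> metric (f x) (D f x v) (D f x w) = metric x v w"
  unfolding isometries_def by blast

lemma isometries_comp: "f \<in> isometries \<Longrightarrow> g \<in> isometries \<Longrightarrow> f \<circ> g \<in> isometries"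
  unfolding isometries_def
  by (clarsimp simp del: split_paired_All simp: bij_comp o_inv_distrib D_compose)
    (simp add: comp_def smooth_compose)

lemma isometries_inv:
  assumes f: "f \<in> isometries"
  shows "inv_into UNIV f \<in> isometries"
proof -
  define g where "g = inv_into UNIV f"
  have fg: "f (g x) = x" and gf: "g (f x) = x" for x
    using f by (auto simp: isometries_def g_def bij_is_surj surj_f_inv_f bij_is_inj)
  have sm: "smooth f" "smooth g"
    using f by (auto simp: isometries_def g_def)
  have *: "D f (g x) (D g x v) = v" for x v
  proof -
    have "f \<circ> g = (\<lambda>x. x)"
      using fg by auto
    then show ?thesis
      using D_compose[OF sm, of x v] by simp
  qed
  have "g \<in> isometries"
  proof (rule isometriesI[OF sm(2,1) gf fg smooth_has_derivative[OF sm(2)]])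
    show "metric (g x) (D g x v) (D g x w) = metric x v w" for x v w
      using isometry_metric[OF f, of "g x" "D g x v" "D g x w"] by (simp add: * fg)
  qed
  then show ?thesis
    by (simp add: g_def)
qed

lemma id_isometry: "id \<in> isometries"
  by (rule isometriesI[of id id "\<lambda>_ v. v"])
    (auto simp: id_def intro: smooth_bounded_linear)

lemma D_isometry_surj:
  assumes f: "f \<in> isometries"
  shows "\<exists>v. D f x v = w"
proof -
  define g where "g = inv_into UNIV f"
  have fg: "f (g x) = x" and gf: "g (f x) = x" for x
    using f by (auto simp: isometries_def g_def bij_is_surj surj_f_inv_f bij_is_inj)
  have "f \<circ> g = (\<lambda>x. x)"
    using fg by auto
  then have "D f (g (f x)) (D g (f x) w) = w"
    using D_compose[of f g "f x" w] f isometries_inv[OF f]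
    by (simp add: smooth_isometry g_def)
  then show ?thesis
    unfolding gf by blast
qed

lemma Isom_simps [simp]:
  "carrier Isom = isometries" "f \<otimes>\<^bsub>Isom\<^esub> g = f \<circ> g" "\<one>\<^bsub>Isom\<^esub> = id"
  by (simp_all add: Isom_def)

lemma group_Isom: "group Isom"
proof (rule groupI)
  fix f assume "f \<in> carrier Isom"
  then have f: "f \<in> isometries"
    by simp
  then have "inv_into UNIV f \<circ> f = id"
    by (simp add: isometries_def bij_is_inj)
  then show "\<exists>g\<in>carrier Isom. g \<otimes>\<^bsub>Isom\<^esub> f = \<one>\<^bsub>Isom\<^esub>"
    using isometries_inv[OF f] by auto
qed (auto simp: isometries_comp id_isometry comp_assoc)

interpretation Isom: group Isom
  by (rule group_Isom)

lemma left_translation_isometry: "left_translation g \<in> isometries"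
proof (rule isometriesI[OF _ _ _ _ has_derivative_left_translation, of _ "left_translation (inv\<^bsub>Q\<^esub> g)"])
  show "smooth (left_translation g)" "smooth (left_translation (inv\<^bsub>Q\<^esub> g))"
    unfolding left_translation_eq by (intro smooth_intros)+
  show "left_translation g (left_translation (inv\<^bsub>Q\<^esub> g) x) = x"
    "left_translation (inv\<^bsub>Q\<^esub> g) (left_translation g x) = x" for x
    by (simp_all add: left_translation_def flip: Q.m_assoc)
qed (simp add: metric_eq left_translation_def exp_minus field_simps)

definition right_translation :: "osc \<Rightarrow> osc \<Rightarrow> osc" where
  "right_translation g x = x \<otimes>\<^bsub>Q\<^esub> g"

lemma right_translation_eq: "right_translation g =
  (\<lambda>x. of_null (zc x + zc g + (pc x * (exp (- tc x) * qc g) - qc x * (exp (tc x) * pc g)) / 4)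
    (pc x + exp (tc x) * pc g) (qc x + exp (- tc x) * qc g) (tc x + tc g))"
  by (rule ext, rule null_eqI) (simp_all add: right_translation_def)

lemma has_derivative_right_translation: "(right_translation g has_derivative
  (\<lambda>v. of_null (zc v + (pc v * (exp (- tc x) * qc g) - pc x * (exp (- tc x) * tc v * qc g)
        - qc v * (exp (tc x) * pc g) - qc x * (exp (tc x) * tc v * pc g)) / 4)
    (pc v + exp (tc x) * tc v * pc g) (qc v - exp (- tc x) * tc v * qc g) (tc v))) (at x)"
  unfolding right_translation_eq
  by (auto intro!: derivative_eq_intros ext arg_cong2[of _ _ _ _ "\<lambda>z p. of_null z p _ _"]
      simp: algebra_simps diff_divide_distrib add_divide_distrib)

text \<open>Right translations preserve the left-invariant metric because \<open>lie_inner\<close> is ad-invariant.\<close>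

lemma right_translation_isometry: "right_translation g \<in> isometries"
proof (rule isometriesI[OF _ _ _ _ has_derivative_right_translation, of _ "right_translation (inv\<^bsub>Q\<^esub> g)"])
  show "smooth (right_translation g)" "smooth (right_translation (inv\<^bsub>Q\<^esub> g))"
    unfolding right_translation_eq by (intro smooth_intros)+
  show "right_translation g (right_translation (inv\<^bsub>Q\<^esub> g) x) = x"
    "right_translation (inv\<^bsub>Q\<^esub> g) (right_translation g x) = x" for x
    by (simp_all add: right_translation_def Q.m_assoc)
qed (simp add: metric_eq right_translation_def exp_minus field_simps)

definition inversion :: "osc \<Rightarrow> osc" where
  "inversion x = inv\<^bsub>Q\<^esub> x"

lemma inversion_eq: "inversion =
  (\<lambda>x. of_null (- zc x) (- (exp (- tc x) * pc x)) (- (exp (tc x) * qc x)) (- tc x))"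
  by (rule ext, rule null_eqI) (simp_all add: inversion_def)

lemma has_derivative_inversion: "(inversion has_derivative
  (\<lambda>v. of_null (- zc v) (exp (- tc x) * (tc v * pc x - pc v))
    (- (exp (tc x) * (tc v * qc x + qc v))) (- tc v))) (at x)"
  unfolding inversion_eq
  by (auto intro!: derivative_eq_intros ext arg_cong2[of _ _ _ _ "\<lambda>p q. of_null _ p q _"]
      simp: algebra_simps)

lemma inversion_isometry: "inversion \<in> isometries"
proof (rule isometriesI[OF _ _ _ _ has_derivative_inversion, of inversion])
  show "smooth inversion"
    unfolding inversion_eq by (intro smooth_intros)
  then show "smooth inversion" .
qed (simp_all add: metric_eq inversion_def exp_minus field_simps)

section \<open>Isometries preserve geodesics\<close>

text \<open>The derivative of the metric coefficients in direction \<open>u\<close>. It involves no base point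
  because the coefficients are affine.\<close>

definition metric_deriv :: "osc \<Rightarrow> osc \<Rightarrow> osc \<Rightarrow> real" where
  "metric_deriv u v w =
    - ((pc u * qc v - qc u * pc v) * tc w + (pc u * qc w - qc u * pc w) * tc v) / 4"

lemma has_derivative_metric:
  assumes "(c has_derivative c') (at x)" "(v has_derivative v') (at x)" "(w has_derivative w') (at x)"
  shows "((\<lambda>y. metric (c y) (v y) (w y)) has_derivative
    (\<lambda>h. metric_deriv (c' h) (v x) (w x) + metric (c x) (v' h) (w x) + metric (c x) (v x) (w' h))) (at x)"
  unfolding metric_eq
  by (auto intro!: derivative_eq_intros assms ext simp: metric_deriv_def field_simps)

lemma metric_add [simp]:
  "metric x (u + v) w = metric x u w + metric x v w" "metric x w (u + v) = metric x w u + metric x w v"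
  by (simp_all add: metric_eq field_simps)

lemma metric_commute: "metric x v w = metric x w v"
  by (simp add: metric_eq field_simps)

text \<open>The metric paired with the covariant acceleration of a curve through \<open>x\<close> with velocity \<open>v\<close>
  and acceleration \<open>a\<close>, the Christoffel symbols being those of the first kind.\<close>

definition koszul :: "osc \<Rightarrow> osc \<Rightarrow> osc \<Rightarrow> osc \<Rightarrow> real" where
  "koszul x v a w = metric x a w + metric_deriv v v w - metric_deriv w v v / 2"

text \<open>The usual argument for the uniqueness of the Levi-Civita connection: the derivatives of the
  identity \<open>metric (f x) (D f x v) (D f x w) = metric x v w\<close> in directions \<open>v\<close> and \<open>w\<close> are
  combined so that, by the symmetry of the second derivative, only \<open>D (\<lambda>y. D f y v) x v\<close> is left.
  The third argument on the left is the acceleration of the image curve.\<close>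

lemma isometry_koszul:
  assumes f: "f \<in> isometries"
  shows "koszul (f x) (D f x v) (D (\<lambda>y. D f y v) x v + D f x a) (D f x w) = koszul x v a w"
proof -
  note sm = smooth_isometry[OF f]
  have *: "metric_deriv (D f x u) (D f x v) (D f x w) + metric (f x) (D (\<lambda>y. D f y v) x u) (D f x w)
      + metric (f x) (D f x v) (D (\<lambda>y. D f y w) x u) = metric_deriv u v w" for u v w
  proof -
    have 1: "((\<lambda>y. metric (f y) (D f y v) (D f y w)) has_derivative (\<lambda>u.
      metric_deriv (D f x u) (D f x v) (D f x w) + metric (f x) (D (\<lambda>y. D f y v) x u) (D f x w)
      + metric (f x) (D f x v) (D (\<lambda>y. D f y w) x u))) (at x)"
      by (intro has_derivative_metric smooth_has_derivative smooth_D sm)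
    have 2: "((\<lambda>y. metric y v w) has_derivative
      (\<lambda>u. metric_deriv u v w + metric x 0 w + metric x v 0)) (at x)"
      by (intro has_derivative_metric has_derivative_ident has_derivative_const)
    have "metric x 0 w = 0" "metric x v 0 = 0"
      by (simp_all add: metric_eq)
    then show ?thesis
      using fun_cong[OF has_derivative_unique[OF 1[unfolded isometry_metric[OF f]] 2], of u]
      by simp
  qed
  show ?thesis
    using *[of v v w] *[of w v v] isometry_metric[OF f, of x a w]
    unfolding koszul_def metric_add mixed_derivatives_commute[OF sm, of w x v]
    by (simp add: metric_commute[of "f x" "D f x v"])
qed

text \<open>The four coordinate vectors for \<open>w\<close> give the four components of the geodesic equation.\<close>

lemma koszul_zero_iff:
  "(\<forall>w. koszul x v a w = 0) \<longleftrightarrow>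
    tc a = 0 \<and> pc a = tc v * pc v \<and> qc a = - (tc v * qc v) \<and>
    zc a = (pc x * qc a - qc x * pc a) / 4" (is "?L \<longleftrightarrow> ?R")
proof
  assume L: ?L
  show ?R
    using L[rule_format, of "of_null 1 0 0 0"] L[rule_format, of "of_null 0 1 0 0"]
      L[rule_format, of "of_null 0 0 1 0"] L[rule_format, of "of_null 0 0 0 1"]
    by (simp add: koszul_def metric_eq metric_deriv_def field_simps)
next
  assume R: ?R
  then have z: "zc a = - (tc v * (pc x * qc v + qc x * pc v) / 4)"
    by (auto simp: field_simps)
  have t: "tc a = 0" and p: "pc a = tc v * pc v" and q: "qc a = - (tc v * qc v)"
    using R by blast+
  show ?L
    unfolding koszul_def metric_eq metric_deriv_def z t p q
    by (simp add: algebra_simps diff_divide_distrib add_divide_distrib)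
qed

definition geodesic :: "(real \<Rightarrow> osc) \<Rightarrow> (real \<Rightarrow> osc) \<Rightarrow> (real \<Rightarrow> osc) \<Rightarrow> bool" where
  "geodesic c c' c'' \<longleftrightarrow> (\<forall>s. (c has_vector_derivative c' s) (at s) \<and>
    (c' has_vector_derivative c'' s) (at s) \<and> (\<forall>w. koszul (c s) (c' s) (c'' s) w = 0))"

text \<open>The product rule for the derivative evaluated at a moving point in a moving direction.\<close>

lemma D_along_curve:
  fixes f :: "'a::euclidean_space \<Rightarrow> 'b::real_normed_vector"
  assumes f: "smooth f"
    and c: "(c has_vector_derivative v s) (at s)" and v: "(v has_vector_derivative a) (at s)"
  shows "((\<lambda>s. D f (c s) (v s)) has_vector_derivative
    D (\<lambda>y. D f y (v s)) (c s) (v s) + D f (c s) a) (at s)"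
proof -
  have expand: "D f y u = (\<Sum>b\<in>Basis. (u \<bullet> b) *\<^sub>R D f y b)" for y u
    by (rule linear_eq_sum_Basis[OF has_derivative_linear[OF smooth_has_derivative[OF f]]])
  have expand2: "D (\<lambda>y. D f y u) y w = (\<Sum>b\<in>Basis. (u \<bullet> b) *\<^sub>R D (\<lambda>y. D f y b) y w)" for y u w
  proof -
    have "((\<lambda>y. \<Sum>b\<in>Basis. (u \<bullet> b) *\<^sub>R D f y b) has_derivative
        (\<lambda>w. \<Sum>b\<in>Basis. (u \<bullet> b) *\<^sub>R D (\<lambda>y. D f y b) y w)) (at y)"
      by (intro has_derivative_sum has_derivative_scaleR_right smooth_has_derivative smooth_D f)
    then show ?thesis
      using frechet_derivative_at by (metis (no_types, lifting) ext expand)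
  qed
  have b: "((\<lambda>s. D f (c s) b) has_vector_derivative D (\<lambda>y. D f y b) (c s) (v s)) (at s)" for b
  proof -
    have "linear (D (\<lambda>y. D f y b) (c s))"
      using smooth_has_derivative[OF smooth_D[OF f]] by (rule has_derivative_linear)
    then show ?thesis
      using has_derivative_compose[OF c[unfolded has_vector_derivative_def]
          smooth_has_derivative[OF smooth_D[OF f, of b]]]
      by (simp add: has_vector_derivative_def linear_scale)
  qed
  have vb: "((\<lambda>s. v s \<bullet> b) has_real_derivative a \<bullet> b) (at s)" for b
    using bounded_linear.has_vector_derivative[OF bounded_linear_inner_left v, of b]
    by (simp add: has_real_derivative_iff_has_vector_derivative)
  have "((\<lambda>s. \<Sum>b\<in>Basis. (v s \<bullet> b) *\<^sub>R D f (c s) b) has_vector_derivative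
      (\<Sum>b\<in>Basis. (v s \<bullet> b) *\<^sub>R D (\<lambda>y. D f y b) (c s) (v s) + (a \<bullet> b) *\<^sub>R D f (c s) b)) (at s)"
    by (intro has_vector_derivative_sum has_vector_derivative_scaleR b vb)
  then show ?thesis
    by (simp add: expand[of "c _" "v _"] expand[of "c s" a] expand2[of "v s"] sum.distrib)
qed

lemma isometry_geodesic:
  assumes f: "f \<in> isometries" and c: "geodesic c c' c''"
  shows "geodesic (\<lambda>s. f (c s)) (\<lambda>s. D f (c s) (c' s))
    (\<lambda>s. D (\<lambda>y. D f y (c' s)) (c s) (c' s) + D f (c s) (c'' s))"
  unfolding geodesic_def
proof (intro allI conjI)
  fix s
  note sm = smooth_isometry[OF f]
  have d: "(c has_vector_derivative c' s) (at s)" "(c' has_vector_derivative c'' s) (at s)"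
    and k: "\<And>w. koszul (c s) (c' s) (c'' s) w = 0"
    using c unfolding geodesic_def by blast+
  have "linear (D f (c s))"
    using smooth_has_derivative[OF sm] by (rule has_derivative_linear)
  then show "((\<lambda>s. f (c s)) has_vector_derivative D f (c s) (c' s)) (at s)"
    using has_derivative_compose[OF d(1)[unfolded has_vector_derivative_def]
        smooth_has_derivative[OF sm]]
    by (simp add: has_vector_derivative_def linear_scale)
  show "((\<lambda>s. D f (c s) (c' s)) has_vector_derivative
      D (\<lambda>y. D f y (c' s)) (c s) (c' s) + D f (c s) (c'' s)) (at s)"
    by (rule D_along_curve[OF sm d])
  show "koszul (f (c s)) (D f (c s) (c' s))
      (D (\<lambda>y. D f y (c' s)) (c s) (c' s) + D f (c s) (c'' s)) w = 0" for w
    using D_isometry_surj[OF f, of "c s" w] isometry_koszul[OF f] k by metis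
qed

lemma has_vector_derivative_of_null:
  assumes "(z has_real_derivative z') F" "(p has_real_derivative p') F"
    "(q has_real_derivative q') F" "(t has_real_derivative t') F"
  shows "((\<lambda>s. of_null (z s) (p s) (q s) (t s)) has_vector_derivative of_null z' p' q' t') F"
proof -
  have *: "(\<lambda>s. of_null (z' * s) (p' * s) (q' * s) (t' * s)) = (\<lambda>s. s *\<^sub>R of_null z' p' q' t')"
    by (rule ext, rule null_eqI) simp_all
  show ?thesis
    using assms unfolding has_vector_derivative_def has_field_derivative_def *[symmetric]
    by (intro has_derivative_of_null)
qed

lemma geodesic_line:
  assumes "tc v = 0"
  shows "geodesic (\<lambda>s. x + s *\<^sub>R v) (\<lambda>s. v) (\<lambda>s. 0)"
  unfolding geodesic_def koszul_zero_iff
  using assms by (auto intro!: derivative_eq_intros)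

text \<open>The geodesics with \<open>t' = 1\<close>. The speed \<open>l\<close> is free because \<open>z\<close> enters the geodesic equation
  only through \<open>z''\<close>.\<close>

lemma geodesic_transversal:
  "geodesic
    (\<lambda>s. of_null (z + k * s + (p * (r * exp (- s)) - q * (u * exp s)) / 4)
      (p + u * exp s) (q + r * exp (- s)) s)
    (\<lambda>s. of_null (k + (p * (- r * exp (- s)) - q * (u * exp s)) / 4)
      (u * exp s) (- r * exp (- s)) 1)
    (\<lambda>s. of_null ((p * (r * exp (- s)) - q * (u * exp s)) / 4) (u * exp s) (r * exp (- s)) 0)"
  unfolding geodesic_def koszul_zero_iff
  by (auto intro!: has_vector_derivative_of_null derivative_eq_intros
      simp: field_simps exp_minus)

section \<open>The equation of the coordinate functions\<close>

text \<open>The equation \<open>y'' = k y'\<close>. Along a geodesic with \<open>t' = c\<close> it holds for the coordinates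
  \<open>t\<close>, \<open>p\<close>, \<open>q\<close> with \<open>k\<close> equal to \<open>0\<close>, \<open>c\<close>, \<open>- c\<close>.\<close>

definition solves_ode :: "real \<Rightarrow> (real \<Rightarrow> real) \<Rightarrow> bool" where
  "solves_ode k y \<longleftrightarrow> (\<exists>y'. \<forall>s. (y has_real_derivative y' s) (at s) \<and>
    (y' has_real_derivative k * y' s) (at s))"

lemma solves_odeI:
  "(\<And>s. (y has_real_derivative y' s) (at s)) \<Longrightarrow>
    (\<And>s. (y' has_real_derivative k * y' s) (at s)) \<Longrightarrow> solves_ode k y"
  unfolding solves_ode_def by blast

lemma solves_ode_diff: "solves_ode k y \<Longrightarrow> solves_ode k w \<Longrightarrow> solves_ode k (\<lambda>s. y s - w s)"
  unfolding solves_ode_def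
proof (elim exE)
  fix y' w'
  assume "\<forall>s. (y has_real_derivative y' s) (at s) \<and> (y' has_real_derivative k * y' s) (at s)"
    "\<forall>s. (w has_real_derivative w' s) (at s) \<and> (w' has_real_derivative k * w' s) (at s)"
  then show "\<exists>y'. \<forall>s. ((\<lambda>s. y s - w s) has_real_derivative y' s) (at s) \<and>
      (y' has_real_derivative k * y' s) (at s)"
    by (intro exI[of _ "\<lambda>s. y' s - w' s"]) (auto intro!: DERIV_diff simp: right_diff_distrib)
qed

lemma solves_ode_cmult: "solves_ode k y \<Longrightarrow> solves_ode k (\<lambda>s. c * y s)"
  unfolding solves_ode_def
proof (elim exE)
  fix y'
  assume "\<forall>s. (y has_real_derivative y' s) (at s) \<and> (y' has_real_derivative k * y' s) (at s)"
  then show "\<exists>y'. \<forall>s. ((\<lambda>s. c * y s) has_real_derivative y' s) (at s) \<and>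
      (y' has_real_derivative k * y' s) (at s)"
    by (intro exI[of _ "\<lambda>s. c * y' s"]) (auto intro!: derivative_eq_intros)
qed

text \<open>Subtracting \<open>h\<close> times the equation for \<open>y\<close> from the equation for \<open>y h\<close> cancels the second
  derivative of \<open>y\<close>.\<close>

lemma solves_ode_times:
  assumes y: "solves_ode k y" and yh: "solves_ode k (\<lambda>s. y s * h s)"
    and h: "\<And>s. (h has_real_derivative h' s) (at s)" "\<And>s. (h' has_real_derivative h'' s) (at s)"
    and nz: "h' s \<noteq> 0"
  shows "(y has_real_derivative (k - h'' s / h' s) / 2 * y s) (at s)"
proof -
  obtain y' where y': "\<And>s. (y has_real_derivative y' s) (at s)"
    "\<And>s. (y' has_real_derivative k * y' s) (at s)"
    using y unfolding solves_ode_def by blast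
  obtain w where w: "\<And>s. ((\<lambda>s. y s * h s) has_real_derivative w s) (at s)"
    "\<And>s. (w has_real_derivative k * w s) (at s)"
    using yh unfolding solves_ode_def by blast
  have "w = (\<lambda>s. y' s * h s + y s * h' s)"
    using DERIV_unique[OF w(1) DERIV_mult[OF y'(1) h(1)]] by (auto simp: algebra_simps)
  moreover have "((\<lambda>s. y' s * h s + y s * h' s) has_real_derivative
      k * y' s * h s + 2 * (y' s * h' s) + y s * h'' s) (at s)"
    by (rule derivative_eq_intros y' h refl)+ (simp add: algebra_simps)
  ultimately have "k * y' s * h s + 2 * (y' s * h' s) + y s * h'' s = k * (y' s * h s + y s * h' s)"
    using DERIV_unique w(2) by blast
  then have "y' s = (k - h'' s / h' s) / 2 * y s"
    using nz by (simp add: field_simps)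
  then show ?thesis
    using y'(1) by metis
qed

text \<open>The first-order equation for \<open>y\<close> is compatible with \<open>y'' = k y'\<close> only for \<open>k\<^sup>2 = r\<^sup>2\<close>,
  unless \<open>y\<close> vanishes.\<close>

lemma solves_ode_times_exp:
  assumes y: "solves_ode k y" and yh: "solves_ode k (\<lambda>s. y s * exp (r * s))" and "r \<noteq> 0"
  shows "(y has_real_derivative (k - r) / 2 * y s) (at s)" "(k\<^sup>2 - r\<^sup>2) * y s = 0"
proof -
  show d: "(y has_real_derivative (k - r) / 2 * y s) (at s)" for s
  proof -
    have "((\<lambda>s. exp (r * s)) has_real_derivative r * exp (r * s)) (at s)"
      "((\<lambda>s. r * exp (r * s)) has_real_derivative r * (r * exp (r * s))) (at s)" for s
      by (auto intro!: derivative_eq_intros)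
    from solves_ode_times[OF y yh this, of s] show ?thesis
      using \<open>r \<noteq> 0\<close> by simp
  qed
  obtain y' where y': "\<And>s. (y has_real_derivative y' s) (at s)"
    "\<And>s. (y' has_real_derivative k * y' s) (at s)"
    using y unfolding solves_ode_def by blast
  have "y' = (\<lambda>s. (k - r) / 2 * y s)"
    using DERIV_unique[OF y'(1) d] by auto
  moreover have "((\<lambda>s. (k - r) / 2 * y s) has_real_derivative (k - r) / 2 * ((k - r) / 2 * y s)) (at s)"
    by (intro DERIV_cmult d)
  ultimately have "(k - r) / 2 * ((k - r) / 2 * y s) = k * ((k - r) / 2 * y s)"
    using DERIV_unique y'(2) by metis
  then show "(k\<^sup>2 - r\<^sup>2) * y s = 0"
    by (auto simp: field_simps power2_eq_square)
qed

lemma solves_ode_times_id: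
  assumes y: "solves_ode k y" and yh: "solves_ode k (\<lambda>s. y s * s)"
  shows "(y has_real_derivative k / 2 * y s) (at s)"
  using solves_ode_times[OF y yh, of "\<lambda>_. 1" "\<lambda>_. 0" s] by (auto intro!: derivative_eq_intros)

lemma DERIV_zero_constant:
  fixes y :: "real \<Rightarrow> real"
  assumes "\<And>s. (y has_real_derivative 0) (at s)"
  shows "\<exists>c. \<forall>s. y s = c"
  using DERIV_isconst_all assms by blast

lemma solves_ode_solution:
  assumes "solves_ode k y" "k \<noteq> 0"
  obtains \<alpha> \<beta> where "\<And>s. y s = \<alpha> + \<beta> * exp (k * s)"
proof -
  obtain y' where y': "\<And>s. (y has_real_derivative y' s) (at s)"
    "\<And>s. (y' has_real_derivative k * y' s) (at s)"
    using assms unfolding solves_ode_def by blast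
  have "((\<lambda>s. y' s * exp (- k * s)) has_real_derivative 0) (at s)" for s
    by (rule derivative_eq_intros y' refl)+ simp
  then obtain B where B: "\<And>s. y' s * exp (- k * s) = B"
    using DERIV_zero_constant by blast
  have y'_eq: "y' s = B * exp (k * s)" for s
    using B[of s] by (simp add: exp_minus field_simps)
  have "((\<lambda>s. y s - B / k * exp (k * s)) has_real_derivative 0) (at s)" for s
    by (rule derivative_eq_intros y' refl)+ (use \<open>k \<noteq> 0\<close> y'_eq in simp)
  then obtain A where "\<And>s. y s - B / k * exp (k * s) = A"
    using DERIV_zero_constant by blast
  then show ?thesis
    using that[of A "B / k"] by (simp add: algebra_simps)
qed

lemma solves_ode_0_solution:
  assumes "solves_ode 0 y"
  shows "y s = y 0 + (y 1 - y 0) * s"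
proof -
  obtain y' where y': "\<And>s. (y has_real_derivative y' s) (at s)"
    "\<And>s. (y' has_real_derivative 0) (at s)"
    using assms unfolding solves_ode_def by auto
  obtain B where B: "\<And>s. y' s = B"
    using DERIV_zero_constant[OF y'(2)] by blast
  have "((\<lambda>s. y s - B * s) has_real_derivative 0) (at s)" for s
    by (rule derivative_eq_intros y' refl)+ (use B in simp)
  then obtain A where "\<And>s. y s - B * s = A"
    using DERIV_zero_constant by blast
  then have "y s = A + B * s" for s
    by (simp add: algebra_simps)
  then show ?thesis
    by simp
qed

lemma affine_on_lines:
  fixes u :: "'a::real_vector \<Rightarrow> real"
  assumes "\<And>x v s. u (x + s *\<^sub>R v) = u x + s * (u (x + v) - u x)"
  shows "linear (\<lambda>x. u x - u 0)"
proof (rule linearI)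
  show h: "u (s *\<^sub>R v) - u 0 = s *\<^sub>R (u v - u 0)" for s v
    using assms[of 0 s v] by simp
  show "u (x + y) - u 0 = u x - u 0 + (u y - u 0)" for x y
  proof -
    \<comment> \<open>Both sides are compared with twice the value at the midpoint.\<close>
    have "x + (1/2) *\<^sub>R (y - x) = (1/2 + 1/2) *\<^sub>R x + (1/2) *\<^sub>R (y - x)"
      by simp
    also have "\<dots> = (1/2) *\<^sub>R (x + y)"
      unfolding scaleR_left_distrib scaleR_right_distrib scaleR_diff_right by simp
    finally have "u ((1/2) *\<^sub>R (x + y)) = u x + (1/2) * (u y - u x)"
      using assms[of x "1/2" "y - x"] by simp
    then show ?thesis
      using h[of "1/2" "x + y"] by (simp add: field_simps)
  qed
qed

text \<open>The lines inside the slices \<open>t = const\<close> force \<open>U\<close> to be affine there. Comparing transversal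
  geodesics then shows that each coefficient solves the equation, both by itself and multiplied by
  the exponential that its coordinate may equal along a geodesic; so it satisfies a first-order
  equation. The coefficient of
  \<open>z\<close> would have to satisfy two different ones, since \<open>z\<close> may grow linearly or exponentially along
  a geodesic, and is therefore 0.\<close>

lemma coordinate_form:
  fixes U :: "osc \<Rightarrow> real"
  assumes line: "\<And>x v. tc v = 0 \<Longrightarrow> solves_ode 0 (\<lambda>s. U (x + s *\<^sub>R v))"
    and trans: "\<And>z l p q u r. solves_ode k
      (\<lambda>s. U (of_null (z + l * s + (p * (r * exp (- s)) - q * (u * exp s)) / 4)
        (p + u * exp s) (q + r * exp (- s)) s))"
  obtains a m n where "\<And>x. U x = a (tc x) + m (tc x) * pc x + n (tc x) * qc x"
    and "solves_ode k a"
    and "\<And>s. (m has_real_derivative (k - 1) / 2 * m s) (at s)"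
    and "\<And>s. (n has_real_derivative (k + 1) / 2 * n s) (at s)"
    and "\<And>s. (k\<^sup>2 - 1) * m s = 0" and "\<And>s. (k\<^sup>2 - 1) * n s = 0"
proof -
  define a where "a t = U (of_null 0 0 0 t)" for t
  define b where "b t = U (of_null 1 0 0 t) - a t" for t
  define m where "m t = U (of_null 0 1 0 t) - a t" for t
  define n where "n t = U (of_null 0 0 1 t) - a t" for t
  have affine: "U (of_null z p q t) = a t + b t * z + m t * p + n t * q" for z p q t
  proof -
    define u where "u = (\<lambda>(z, p, q). U (of_null z p q t))"
    have "linear (\<lambda>x. u x - u 0)"
    proof (rule affine_on_lines)
      fix x v :: "real \<times> real \<times> real" and s :: real
      obtain z p q z' p' q' where xv: "x = (z, p, q)" "v = (z', p', q')"
        by (metis prod_cases3)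
      have u: "u (x + s *\<^sub>R v) = U (of_null z p q t + s *\<^sub>R of_null z' p' q' 0)" for s
        unfolding u_def xv by (simp, rule arg_cong[of _ _ U], rule null_eqI) simp_all
      have "solves_ode 0 (\<lambda>s. u (x + s *\<^sub>R v))"
        unfolding u by (rule line) simp
      then show "u (x + s *\<^sub>R v) = u x + s * (u (x + v) - u x)"
        using solves_ode_0_solution[of "\<lambda>s. u (x + s *\<^sub>R v)" s] by (simp add: mult.commute)
    qed
    then have lin: "linear (\<lambda>x. u x - u (0, 0, 0))"
      by (simp add: zero_prod_def)
    have "(z, p, q) = z *\<^sub>R (1, 0, 0) + (p *\<^sub>R (0, 1, 0) + q *\<^sub>R (0, 0, 1 :: real))"
      by simp
    then have "u (z, p, q) - u (0, 0, 0) = z *\<^sub>R (u (1, 0, 0) - u (0, 0, 0)) +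
      (p *\<^sub>R (u (0, 1, 0) - u (0, 0, 0)) + q *\<^sub>R (u (0, 0, 1) - u (0, 0, 0)))"
      using linear_add[OF lin] linear_scale[OF lin] by metis
    then show ?thesis
      by (simp add: u_def a_def b_def m_def n_def algebra_simps)
  qed
  note T = trans[unfolded affine]
  have a: "solves_ode k a"
    using T[of 0 0 0 0 0 0] by simp
  have b: "solves_ode k b"
    using solves_ode_diff[OF T[of 1 0 0 0 0 0] a] by simp
  have m: "solves_ode k m"
    using solves_ode_diff[OF T[of 0 0 1 0 0 0] a] by simp
  have n: "solves_ode k n"
    using solves_ode_diff[OF T[of 0 0 0 0 1 0] a] by simp
  have bs: "solves_ode k (\<lambda>s. b s * s)"
    using solves_ode_diff[OF T[of 0 1 0 0 0 0] a] by simp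
  have me: "solves_ode k (\<lambda>s. m s * exp (1 * s))"
    using solves_ode_diff[OF T[of 0 0 0 0 0 1] a] by simp
  have ne: "solves_ode k (\<lambda>s. n s * exp (- 1 * s))"
    using solves_ode_diff[OF T[of 0 0 0 1 0 0] a] by simp
  \<comment> \<open>Along the transversal geodesic with \<open>q = u = 1\<close> the coordinate \<open>z\<close> is \<open>- exp s / 4\<close>.\<close>
  have "solves_ode k (\<lambda>s. b s * exp (1 * s))"
    using solves_ode_cmult[OF solves_ode_diff[OF solves_ode_diff[OF solves_ode_diff[OF
            T[of 0 0 0 0 1 1] a] me] n], of "-4"] by (simp add: algebra_simps)
  then have "(k - 1) / 2 * b s = k / 2 * b s" for s
    using DERIV_unique solves_ode_times_exp(1)[OF b] solves_ode_times_id[OF b bs]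
    by (metis zero_neq_one)
  then have "b s = 0" for s
    by (simp add: field_simps)
  then have "U x = a (tc x) + m (tc x) * pc x + n (tc x) * qc x" for x
    using affine[of "zc x" "pc x" "qc x" "tc x"] by simp
  then show ?thesis
    using that[of a m n] a solves_ode_times_exp[OF m me] solves_ode_times_exp[OF n ne] by simp
qed

section \<open>Classification of the isometries\<close>

lemma geodesic_coordinates:
  assumes "geodesic c c' c''"
  shows "((\<lambda>s. tc (c s)) has_real_derivative tc (c' s)) (at s)"
    and "((\<lambda>s. tc (c' s)) has_real_derivative 0) (at s)"
    and "((\<lambda>s. pc (c s)) has_real_derivative pc (c' s)) (at s)"
    and "((\<lambda>s. pc (c' s)) has_real_derivative tc (c' s) * pc (c' s)) (at s)"
    and "((\<lambda>s. qc (c s)) has_real_derivative qc (c' s)) (at s)"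
    and "((\<lambda>s. qc (c' s)) has_real_derivative - tc (c' s) * qc (c' s)) (at s)"
proof -
  have d: "(c has_vector_derivative c' s) (at s)" "(c' has_vector_derivative c'' s) (at s)"
    and k: "tc (c'' s) = 0" "pc (c'' s) = tc (c' s) * pc (c' s)" "qc (c'' s) = - (tc (c' s) * qc (c' s))"
    using assms unfolding geodesic_def koszul_zero_iff by blast+
  note L = bounded_linear_null[THEN bounded_linear.has_vector_derivative]
  show "((\<lambda>s. tc (c s)) has_real_derivative tc (c' s)) (at s)"
    "((\<lambda>s. tc (c' s)) has_real_derivative 0) (at s)"
    "((\<lambda>s. pc (c s)) has_real_derivative pc (c' s)) (at s)"
    "((\<lambda>s. pc (c' s)) has_real_derivative tc (c' s) * pc (c' s)) (at s)"
    "((\<lambda>s. qc (c s)) has_real_derivative qc (c' s)) (at s)"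
    "((\<lambda>s. qc (c' s)) has_real_derivative - tc (c' s) * qc (c' s)) (at s)"
    using L[OF d(1)] L[OF d(2)] by (simp_all add: has_real_derivative_iff_has_vector_derivative k)
qed

lemma D_line:
  assumes f: "smooth f" and h: "bounded_linear h"
    and d: "((\<lambda>s. h (f (x + s *\<^sub>R v))) has_real_derivative e) (at 0)"
  shows "h (D f x v) = e"
proof -
  have "((\<lambda>s. x + s *\<^sub>R v) has_derivative (\<lambda>s. s *\<^sub>R v)) (at 0)"
    by (auto intro!: derivative_eq_intros)
  moreover have "((\<lambda>y. h (f y)) has_derivative (\<lambda>w. h (D f x w))) (at (x + 0 *\<^sub>R v))"
    using bounded_linear.has_derivative[OF h smooth_has_derivative[OF f]] by simp
  ultimately have "((\<lambda>s. h (f (x + s *\<^sub>R v))) has_derivative (\<lambda>s. h (D f x (s *\<^sub>R v)))) (at 0)"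
    by (rule has_derivative_compose)
  then have "((\<lambda>s. h (f (x + s *\<^sub>R v))) has_real_derivative h (D f x v)) (at 0)"
    by (simp add: has_field_derivative_def linear_scale[OF bounded_linear.linear[OF h]]
        linear_scale[OF has_derivative_linear[OF smooth_has_derivative[OF f]]] mult_commute_abs)
  then show ?thesis
    using d DERIV_unique by blast
qed

text \<open>For the \<open>t\<close>-component \<open>k = 0\<close>, so \<open>coordinate_form\<close> leaves only an affine function of \<open>t\<close>,
  with slope \<open>c\<close>, say. Hence \<open>f\<close> maps transversal geodesics to geodesics with \<open>t' = c\<close>, and
  \<open>coordinate_form\<close> applies to the other components with \<open>k = c\<close> and \<open>k = - c\<close>. If \<open>c\<^sup>2\<close> were
  not 1, the \<open>p\<close>-component would depend on \<open>t\<close> only, although \<open>f\<close> preserves the nondegenerate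
  form \<open>p q\<close> on the planes with \<open>z\<close> and \<open>t\<close> fixed.\<close>

theorem isometry_form:
  assumes f: "f \<in> isometries"
  obtains c d a m n a' m' n' where "c\<^sup>2 = 1"
    and "\<And>x. tc (f x) = c * tc x + d"
    and "\<And>x. pc (f x) = a (tc x) + m (tc x) * pc x + n (tc x) * qc x"
    and "\<And>x. qc (f x) = a' (tc x) + m' (tc x) * pc x + n' (tc x) * qc x"
    and "solves_ode c a" "solves_ode (- c) a'"
    and "\<And>s. (m has_real_derivative (c - 1) / 2 * m s) (at s)"
    and "\<And>s. m s * m' s = 0" "\<And>s. n s * n' s = 0" "\<And>s. m s * n' s + n s * m' s = 1"
proof -
  note sm = smooth_isometry[OF f]
  note line_image = geodesic_coordinates[OF isometry_geodesic[OF f geodesic_line]]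
  note transversal_image = geodesic_coordinates[OF isometry_geodesic[OF f geodesic_transversal]]
  have line: "solves_ode 0 (\<lambda>s. tc (f (x + s *\<^sub>R v)))" if "tc v = 0" for x v
    by (rule solves_odeI[OF line_image(1)[OF that]]) (simp add: line_image(2)[OF that])
  obtain a0 m0 n0 where t0: "\<And>x. tc (f x) = a0 (tc x) + m0 (tc x) * pc x + n0 (tc x) * qc x"
    and t1: "solves_ode 0 a0" and t2: "\<And>s. (0\<^sup>2 - 1) * m0 s = 0" "\<And>s. (0\<^sup>2 - 1) * n0 s = 0"
  proof (rule coordinate_form[of "\<lambda>x. tc (f x)" 0, OF line])
    show "solves_ode 0 (\<lambda>s. tc (f (of_null (z + l * s + (p * (r * exp (- s)) - q * (u * exp s)) / 4)
        (p + u * exp s) (q + r * exp (- s)) s)))" for z l p q u r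
      by (rule solves_odeI[OF transversal_image(1)]) (unfold mult_zero_left, rule transversal_image(2))
  qed (assumption | rule that)+
  define c d where "c = a0 1 - a0 0" and "d = a0 0"
  have t: "tc (f x) = c * tc x + d" for x
    using t0 t2 solves_ode_0_solution[OF t1, of "tc x"] by (simp add: c_def d_def)
  have Dt: "tc (D f x v) = c * tc v" for x v
    by (rule D_line[OF sm bounded_linear_null(4)]) (auto simp: t intro!: derivative_eq_intros)
  have line_pq: "solves_ode 0 (\<lambda>s. pc (f (x + s *\<^sub>R v)))" "solves_ode 0 (\<lambda>s. qc (f (x + s *\<^sub>R v)))"
    if "tc v = 0" for x v
    by (rule solves_odeI[OF line_image(3)[OF that] line_image(4)[OF that, unfolded Dt that mult_zero_right]],
      rule solves_odeI[OF line_image(5)[OF that] line_image(6)[OF that, unfolded Dt that mult_zero_right minus_zero]])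
  have trans_pq:
    "solves_ode c (\<lambda>s. pc (f (of_null (z + l * s + (p * (r * exp (- s)) - q * (u * exp s)) / 4)
        (p + u * exp s) (q + r * exp (- s)) s)))"
    "solves_ode (- c) (\<lambda>s. qc (f (of_null (z + l * s + (p * (r * exp (- s)) - q * (u * exp s)) / 4)
        (p + u * exp s) (q + r * exp (- s)) s)))" for z l p q u r
    by (rule solves_odeI[OF transversal_image(3) transversal_image(4)[unfolded Dt null_of_null mult_1_right]],
      rule solves_odeI[OF transversal_image(5) transversal_image(6)[unfolded Dt null_of_null mult_1_right]])
  obtain a m n where p: "\<And>x. pc (f x) = a (tc x) + m (tc x) * pc x + n (tc x) * qc x"
    and a: "solves_ode c a" and m: "\<And>s. (m has_real_derivative (c - 1) / 2 * m s) (at s)"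
    and cm: "\<And>s. (c\<^sup>2 - 1) * m s = 0" and cn: "\<And>s. (c\<^sup>2 - 1) * n s = 0"
    using coordinate_form[OF line_pq(1) trans_pq(1)] by (metis (no_types, lifting))
  obtain a' m' n' where q: "\<And>x. qc (f x) = a' (tc x) + m' (tc x) * pc x + n' (tc x) * qc x"
    and a': "solves_ode (- c) a'"
    using coordinate_form[OF line_pq(2) trans_pq(2)] by (metis (no_types, lifting))
  have pairing: "(m s * u + n s * w) * (m' s * u + n' s * w) = u * w" for s u w
  proof -
    define x v where "x = of_null 0 0 0 s" and "v = of_null 0 u w 0"
    have "pc (D f x v) = m s * u + n s * w"
      by (rule D_line[OF sm bounded_linear_null(2)])
        (auto simp: p x_def v_def intro!: derivative_eq_intros)
    moreover have "qc (D f x v) = m' s * u + n' s * w"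
      by (rule D_line[OF sm bounded_linear_null(3)])
        (auto simp: q x_def v_def intro!: derivative_eq_intros)
    ultimately show ?thesis
      using isometry_metric[OF f, of x v v] by (simp add: metric_eq Dt v_def mult.commute)
  qed
  have o1: "m s * m' s = 0" and o2: "n s * n' s = 0" for s
    using pairing[of s 1 0] pairing[of s 0 1] by simp_all
  have o3: "m s * n' s + n s * m' s = 1" for s
    using pairing[of s 1 1] o1[of s] o2[of s] by (auto simp: algebra_simps)
  have "c\<^sup>2 = 1"
    using o3[of 0] cm[of 0] cn[of 0] by auto
  then show ?thesis
    by (rule that[OF _ t p q a a' m o1 o2 o3])
qed

text \<open>The metric coefficients do not involve \<open>z\<close>, so the difference of the metric identities
  for \<open>f\<close> and \<open>g\<close> is linear in the difference of the derivatives of their \<open>z\<close>-components. Pairing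
  with a vector whose image has \<open>t\<close>-component 1 shows that this difference vanishes.\<close>

lemma isometry_eq_up_to_centre:
  assumes f: "f \<in> isometries" and g: "g \<in> isometries"
    and eq: "\<And>x. pc (f x) = pc (g x)" "\<And>x. qc (f x) = qc (g x)" "\<And>x. tc (f x) = tc (g x)"
  obtains k where "\<And>x. zc (f x) = zc (g x) + k"
proof -
  note sf = smooth_isometry[OF f] and sg = smooth_isometry[OF g]
  have "l (D f x v) = l (D g x v)"
    if "bounded_linear l" "\<And>x. l (f x) = l (g x)" for l :: "osc \<Rightarrow> real" and x v
    using D_bounded_linear_compose[OF that(1) sf, of x v] D_bounded_linear_compose[OF that(1) sg, of x v]
    by (simp add: that(2))
  note Deq = this[OF bounded_linear_null(2) eq(1)] this[OF bounded_linear_null(3) eq(2)]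
    this[OF bounded_linear_null(4) eq(3)]
  have *: "(zc (D f x v) - zc (D g x v)) * tc (D f x w) + (zc (D f x w) - zc (D g x w)) * tc (D f x v) = 0"
    for x v w
    using isometry_metric[OF f, of x v w] isometry_metric[OF g, of x v w]
    by (simp add: metric_eq eq Deq algebra_simps)
  have "zc (D f x v) - zc (D g x v) = 0" for x v
  proof -
    obtain w where "D f x w = of_null 0 0 0 1"
      using D_isometry_surj[OF f] by blast
    then have w: "tc (D f x w) = 1"
      by simp
    have "zc (D f x w) - zc (D g x w) = 0"
      using *[of x w w] w by simp
    then show ?thesis
      using *[of x v w] w by simp
  qed
  moreover have "((\<lambda>x. zc (f x) - zc (g x)) has_derivative (\<lambda>v. zc (D f x v) - zc (D g x v))) (at x)" for x
    by (intro derivative_intros smooth_has_derivative sf sg)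
  ultimately have "((\<lambda>x. zc (f x) - zc (g x)) has_derivative (\<lambda>v. 0)) (at x)" for x
    by simp
  then obtain k where "zc (f x) - zc (g x) = k" for x
    using has_derivative_zero_constant[OF convex_UNIV, of "\<lambda>x. zc (f x) - zc (g x)"] by auto
  then show ?thesis
    using that[of k] by (simp add: algebra_simps)
qed

text \<open>The sign conditions give \<open>c = 1\<close> and rule out that \<open>f\<close> interchanges or reflects the two null
  directions. The coefficients in \<open>isometry_form\<close> are then exactly those of a two-sided
  translation.\<close>

theorem isometry_translations:
  assumes f: "f \<in> isometries"
    and pos: "tc (f (of_null 0 0 0 1)) > tc (f 0)" "pc (f (of_null 0 1 0 0)) > pc (f 0)"
  obtains g h where "f = (\<lambda>x. g \<otimes>\<^bsub>Q\<^esub> x \<otimes>\<^bsub>Q\<^esub> h)"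
proof -
  obtain c d a m n a' m' n' where c2: "c\<^sup>2 = 1"
    and t: "\<And>x. tc (f x) = c * tc x + d"
    and p: "\<And>x. pc (f x) = a (tc x) + m (tc x) * pc x + n (tc x) * qc x"
    and q: "\<And>x. qc (f x) = a' (tc x) + m' (tc x) * pc x + n' (tc x) * qc x"
    and a: "solves_ode c a" and a': "solves_ode (- c) a'"
    and m: "\<And>s. (m has_real_derivative (c - 1) / 2 * m s) (at s)"
    and o: "\<And>s. m s * m' s = 0" "\<And>s. n s * n' s = 0" "\<And>s. m s * n' s + n s * m' s = 1"
    using isometry_form[OF f] by (metis (no_types, lifting))
  have "c = 1"
    using pos(1) c2 by (auto simp: t power2_eq_1_iff)
  then have "\<And>s. (m has_real_derivative 0) (at s)"
    using m by simp
  then obtain m0 where m0: "\<And>s. m s = m0"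
    using DERIV_zero_constant by blast
  have "m0 > 0"
    using pos(2) by (simp add: p m0)
  then have m': "m' s = 0" and n': "n' s = 1 / m0" and n: "n s = 0" for s
    using o[of s] by (auto simp: m0 field_simps)
  obtain \<alpha> \<beta> where ab: "\<And>s. a s = \<alpha> + \<beta> * exp s"
    using solves_ode_solution[OF a] \<open>c = 1\<close> by auto
  obtain \<alpha>' \<beta>' where ab': "\<And>s. a' s = \<alpha>' + \<beta>' * exp (- s)"
    using solves_ode_solution[OF a'] \<open>c = 1\<close> by auto
  \<comment> \<open>In \<open>g x h\<close> the left factor contributes the constants and the scaling of the plane, while the
    plane component of \<open>h\<close> is multiplied by exponentials of \<open>t\<close>.\<close>
  define g where "g z = of_null z \<alpha> \<alpha>' (ln m0)" for z
  define h where "h = of_null 0 (\<beta> / m0) (\<beta>' * m0) (d - ln m0)"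
  let ?f = "\<lambda>z x. g z \<otimes>\<^bsub>Q\<^esub> x \<otimes>\<^bsub>Q\<^esub> h"
  have coords: "pc (f x) = pc (?f z x)" "qc (f x) = qc (?f z x)" "tc (f x) = tc (?f z x)" for x z
    using \<open>m0 > 0\<close>
    by (simp_all add: p q t ab ab' m0 n n' m' \<open>c = 1\<close> g_def h_def exp_add exp_minus exp_diff field_simps)
  have "?f 0 = right_translation h \<circ> left_translation (g 0)"
    by (auto simp: right_translation_def left_translation_def)
  then have iso: "?f 0 \<in> isometries"
    using isometries_comp[OF right_translation_isometry left_translation_isometry] by simp
  obtain k where "\<And>x. zc (f x) = zc (?f 0 x) + k"
    using isometry_eq_up_to_centre[OF f iso coords] by blast
  then have "zc (f x) = zc (?f k x)" for x
    by (simp add: g_def)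
  then have "f = ?f k"
    using coords by (intro ext null_eqI) auto
  then show ?thesis
    by (rule that)
qed

section \<open>Two-sided translations\<close>

text \<open>The map $(z,\xi,t) \mapsto (z, e^{tA}\bar\xi, t)$, since conjugation sends \<open>(p, q)\<close> to
  \<open>(- q, - p)\<close>. It is the inversion followed by the automorphism
  $(z,\xi,t) \mapsto (-z, -\bar\xi, -t)$, hence an anti-automorphism. It keeps the sign of \<open>z\<close>
  and \<open>t\<close>, so that the components of both factors add up in \<open>two_sided\<close>.\<close>

definition flip :: "osc \<Rightarrow> osc" where
  "flip x = of_null (zc x) (- exp (tc x) * qc x) (- exp (- tc x) * pc x) (tc x)"

lemma null_flip [simp]:
  "zc (flip x) = zc x" "pc (flip x) = - exp (tc x) * qc x"
  "qc (flip x) = - exp (- tc x) * pc x" "tc (flip x) = tc x"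
  by (simp_all add: flip_def)

lemma flip_mult: "flip (x \<otimes>\<^bsub>Q\<^esub> y) = flip y \<otimes>\<^bsub>Q\<^esub> flip x"
  by (rule null_eqI) (simp_all add: exp_add exp_minus exp_diff field_simps)

lemma flip_flip [simp]: "flip (flip x) = x"
  by (rule null_eqI) (simp_all add: exp_minus)

lemma flip_one [simp]: "flip \<one>\<^bsub>Q\<^esub> = \<one>\<^bsub>Q\<^esub>"
  by (rule null_eqI) simp_all

definition two_sided :: "osc \<Rightarrow> osc \<Rightarrow> osc \<Rightarrow> osc" where
  "two_sided g h x = g \<otimes>\<^bsub>Q\<^esub> x \<otimes>\<^bsub>Q\<^esub> flip h"

lemma two_sided_mult:
  "two_sided (g \<otimes>\<^bsub>Q\<^esub> g') (h \<otimes>\<^bsub>Q\<^esub> h') = two_sided g h \<circ> two_sided g' h'"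
  by (rule ext) (simp add: two_sided_def flip_mult Q.m_assoc)

lemma two_sided_one: "two_sided \<one>\<^bsub>Q\<^esub> \<one>\<^bsub>Q\<^esub> = id"
  by (rule ext) (simp add: two_sided_def)

lemma two_sided_isometry: "two_sided g h \<in> isometries"
proof -
  have "two_sided g h = right_translation (flip h) \<circ> left_translation g"
    by (auto simp: two_sided_def right_translation_def left_translation_def)
  then show ?thesis
    using isometries_comp[OF right_translation_isometry left_translation_isometry] by simp
qed

lemma two_sided_eq:
  "two_sided g h x = of_null
    (zc g + zc h + zc x + (pc g * exp (- tc g) * qc x - qc g * exp (tc g) * pc x
      + (qc g + exp (- tc g) * qc x) * exp (tc g + tc x) * exp (tc h) * qc h
      - (pc g + exp (tc g) * pc x) * exp (- tc g - tc x) * exp (- tc h) * pc h) / 4)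
    (pc g + exp (tc g) * pc x - exp (tc g + tc x) * exp (tc h) * qc h)
    (qc g + exp (- tc g) * qc x - exp (- tc g - tc x) * exp (- tc h) * pc h)
    (tc g + tc x + tc h)"
  by (rule null_eqI) (simp_all add: two_sided_def algebra_simps add_divide_distrib diff_divide_distrib)

text \<open>The pair \<open>(g, h)\<close> matters only up to the antidiagonal copy of the centre of \<open>Q\<close>.\<close>

lemma two_sided_cong:
  assumes "zc g + zc h = zc g' + zc h'"
    "pc g = pc g'" "qc g = qc g'" "tc g = tc g'" "pc h = pc h'" "qc h = qc h'" "tc h = tc h'"
  shows "two_sided g h = two_sided g' h'"
  using assms by (intro ext) (simp add: two_sided_eq)

type_synonym osc2r = "(heis2 \<times> real) \<times> real"

text \<open>The maps $\xi_1 \pm A\xi_2$ decouple the two plane components: since $A$ reverses the sign of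
  $\omega$, the form $\omega(\xi_1,\hat\xi_1) - \omega(\xi_2,\hat\xi_2)$ becomes half the sum
  of the two values of $\omega$, and $e^{s\phi}$ acts by $e^{sA}$ and $e^{-sA}$. The central
  component is given to both parts in equal shares, as only their sum matters for \<open>two_sided\<close>.\<close>

definition left_part :: "osc2r \<Rightarrow> osc" where
  "left_part k = (fst (fst (fst k)), fst (snd (fst (fst k))) + mat_A (snd (snd (fst (fst k)))),
    snd (fst k) + snd k)"

definition right_part :: "osc2r \<Rightarrow> osc" where
  "right_part k = (fst (fst (fst k)), fst (snd (fst (fst k))) - mat_A (snd (snd (fst (fst k)))),
    snd (fst k) - snd k)"

definition merge :: "osc \<Rightarrow> osc \<Rightarrow> osc2r" where
  "merge g h = ((((zc g + zc h) / 2, (1/2) *\<^sub>R (fst (snd g) + fst (snd h)),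
    mat_A ((1/2) *\<^sub>R (fst (snd g) - fst (snd h)))), (tc g + tc h) / 2), (tc g - tc h) / 2)"

lemma merge_parts [simp]: "merge (left_part k) (right_part k) = k"
  by (cases k) (auto simp: merge_def left_part_def right_part_def zc_def tc_def mat_A_def complex_eq_iff)

lemma parts_merge [simp]:
  "zc (left_part (merge g h)) = (zc g + zc h) / 2" "zc (right_part (merge g h)) = (zc g + zc h) / 2"
  "pc (left_part (merge g h)) = pc g" "pc (right_part (merge g h)) = pc h"
  "qc (left_part (merge g h)) = qc g" "qc (right_part (merge g h)) = qc h"
  "tc (left_part (merge g h)) = tc g" "tc (right_part (merge g h)) = tc h"
  by (simp_all add: merge_def left_part_def right_part_def null_defs mat_A_def field_simps)

lemma carrier_Osc2 [simp]: "carrier Osc2 = UNIV" "carrier Osc2_R = UNIV"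
  by (simp_all add: Osc2_def Osc2_R_def semidirect_real_def H2_def)

text \<open>The parts are multiplicative up to the antidiagonal copy of the centre: the \<open>z\<close>-components of
  the two products differ in general, but their sum is right.\<close>

lemma parts_mult:
  "zc (left_part (k \<otimes>\<^bsub>Osc2_R\<^esub> l)) + zc (right_part (k \<otimes>\<^bsub>Osc2_R\<^esub> l)) =
    zc (left_part k \<otimes>\<^bsub>Q\<^esub> left_part l) + zc (right_part k \<otimes>\<^bsub>Q\<^esub> right_part l)"
  "pc (left_part (k \<otimes>\<^bsub>Osc2_R\<^esub> l)) = pc (left_part k \<otimes>\<^bsub>Q\<^esub> left_part l)"
  "qc (left_part (k \<otimes>\<^bsub>Osc2_R\<^esub> l)) = qc (left_part k \<otimes>\<^bsub>Q\<^esub> left_part l)"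
  "tc (left_part (k \<otimes>\<^bsub>Osc2_R\<^esub> l)) = tc (left_part k \<otimes>\<^bsub>Q\<^esub> left_part l)"
  "pc (right_part (k \<otimes>\<^bsub>Osc2_R\<^esub> l)) = pc (right_part k \<otimes>\<^bsub>Q\<^esub> right_part l)"
  "qc (right_part (k \<otimes>\<^bsub>Osc2_R\<^esub> l)) = qc (right_part k \<otimes>\<^bsub>Q\<^esub> right_part l)"
  "tc (right_part (k \<otimes>\<^bsub>Osc2_R\<^esub> l)) = tc (right_part k \<otimes>\<^bsub>Q\<^esub> right_part l)"
proof -
  obtain z \<xi> \<eta> t s where k: "k = (((z, \<xi>, \<eta>), t), s)"
    by (metis prod.collapse)
  obtain z' \<xi>' \<eta>' t' s' where l: "l = (((z', \<xi>', \<eta>'), t'), s')"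
    by (metis prod.collapse)
  define u v where "u = fst (exp_sphi s (\<xi>', \<eta>'))" and "v = snd (exp_sphi s (\<xi>', \<eta>'))"
  define a b where "a = exp_tA t u" and "b = exp_tA t v"
  have kl: "k \<otimes>\<^bsub>Osc2_R\<^esub> l =
      (((z + z' + 1/2 * (omega \<xi> a - omega \<eta> b), \<xi> + a, \<eta> + b), t + t'), s + s')"
    by (simp add: k l Osc2_def Osc2_R_def semidirect_real_def H2_def s_action_def a_def b_def u_def v_def
        split: prod.split)
  have uv: "Re u = cosh s * Re \<xi>' + sinh s * Re \<eta>'" "Im u = cosh s * Im \<xi>' + sinh s * Im \<eta>'"
    "Re v = sinh s * Re \<xi>' + cosh s * Re \<eta>'" "Im v = sinh s * Im \<xi>' + cosh s * Im \<eta>'"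
    by (simp_all add: u_def v_def exp_sphi_eq)
  \<comment> \<open>In null coordinates the actions of \<open>t\<close> and \<open>s\<close> on both parts are diagonal.\<close>
  have ab: "Im a + Re a = exp t * (Im u + Re u)" "Im a - Re a = exp (- t) * (Im u - Re u)"
    "Im b + Re b = exp t * (Im v + Re v)" "Im b - Re b = exp (- t) * (Im v - Re v)"
    by (simp_all add: a_def b_def exp_tA_eq cosh_def sinh_def field_simps)
  have uv': "(Im u + Re u) + (Im v + Re v) = exp s * ((Im \<xi>' + Re \<xi>') + (Im \<eta>' + Re \<eta>'))"
    "(Im u - Re u) - (Im v - Re v) = exp (- s) * ((Im \<xi>' - Re \<xi>') - (Im \<eta>' - Re \<eta>'))"
    "(Im u + Re u) - (Im v + Re v) = exp (- s) * ((Im \<xi>' + Re \<xi>') - (Im \<eta>' + Re \<eta>'))"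
    "(Im u - Re u) + (Im v - Re v) = exp s * ((Im \<xi>' - Re \<xi>') + (Im \<eta>' - Re \<eta>'))"
    by (simp_all add: uv cosh_def sinh_def field_simps)
  have lp: "pc (left_part l) = (Im \<xi>' + Re \<xi>') + (Im \<eta>' + Re \<eta>')"
    "qc (left_part l) = (Im \<xi>' - Re \<xi>') - (Im \<eta>' - Re \<eta>')"
    "pc (right_part l) = (Im \<xi>' + Re \<xi>') - (Im \<eta>' + Re \<eta>')"
    "qc (right_part l) = (Im \<xi>' - Re \<xi>') + (Im \<eta>' - Re \<eta>')"
    "tc (left_part k) = t + s" "tc (right_part k) = t - s"
    by (simp_all add: k l left_part_def right_part_def null_defs mat_A_def)
  have twisted: "exp (tc (left_part k)) * pc (left_part l) = (Im a + Re a) + (Im b + Re b)"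
    "exp (- tc (left_part k)) * qc (left_part l) = (Im a - Re a) - (Im b - Re b)"
    "exp (tc (right_part k)) * pc (right_part l) = (Im a + Re a) - (Im b + Re b)"
    "exp (- tc (right_part k)) * qc (right_part l) = (Im a - Re a) + (Im b - Re b)"
    unfolding ab lp right_diff_distrib[symmetric] distrib_left[symmetric] uv'
    by (simp_all add: exp_add exp_diff exp_minus field_simps)
  show "pc (left_part (k \<otimes>\<^bsub>Osc2_R\<^esub> l)) = pc (left_part k \<otimes>\<^bsub>Q\<^esub> left_part l)"
    "qc (left_part (k \<otimes>\<^bsub>Osc2_R\<^esub> l)) = qc (left_part k \<otimes>\<^bsub>Q\<^esub> left_part l)"
    "tc (left_part (k \<otimes>\<^bsub>Osc2_R\<^esub> l)) = tc (left_part k \<otimes>\<^bsub>Q\<^esub> left_part l)"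
    "pc (right_part (k \<otimes>\<^bsub>Osc2_R\<^esub> l)) = pc (right_part k \<otimes>\<^bsub>Q\<^esub> right_part l)"
    "qc (right_part (k \<otimes>\<^bsub>Osc2_R\<^esub> l)) = qc (right_part k \<otimes>\<^bsub>Q\<^esub> right_part l)"
    "tc (right_part (k \<otimes>\<^bsub>Osc2_R\<^esub> l)) = tc (right_part k \<otimes>\<^bsub>Q\<^esub> right_part l)"
    unfolding null_mult twisted kl
    by (simp_all add: k l left_part_def right_part_def null_defs mat_A_def)
  show "zc (left_part (k \<otimes>\<^bsub>Osc2_R\<^esub> l)) + zc (right_part (k \<otimes>\<^bsub>Osc2_R\<^esub> l)) =
    zc (left_part k \<otimes>\<^bsub>Q\<^esub> left_part l) + zc (right_part k \<otimes>\<^bsub>Q\<^esub> right_part l)"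
    unfolding null_mult mult.assoc twisted kl
    by (simp add: k l left_part_def right_part_def null_defs mat_A_def omega_def field_simps)
qed

definition act :: "osc2r \<Rightarrow> osc \<Rightarrow> osc" where
  "act k = two_sided (left_part k) (right_part k)"

lemma act_mult: "act (k \<otimes>\<^bsub>Osc2_R\<^esub> l) = act k \<circ> act l"
  unfolding act_def two_sided_mult[symmetric]
  by (rule two_sided_cong) (rule parts_mult)+

lemma act_merge: "act (merge g h) = two_sided g h"
  unfolding act_def by (rule two_sided_cong) simp_all

lemma range_act: "range act = {two_sided g h | g h. True}"
proof
  show "range act \<subseteq> {two_sided g h | g h. True}"
    unfolding act_def by blast
  show "{two_sided g h | g h. True} \<subseteq> range act"
  proof clarify
    show "two_sided g h \<in> range act" for g h
      by (metis act_merge rangeI)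
  qed
qed

lemma range_act_Osc2: "range (\<lambda>k. act (k, 0)) = {two_sided g h | g h. tc g = tc h}"
proof safe
  fix k
  have "tc (left_part (k, 0)) = tc (right_part (k, 0))"
    by (simp add: left_part_def right_part_def tc_def)
  then show "\<exists>g h. act (k, 0) = two_sided g h \<and> tc g = tc h"
    using act_def by metis
next
  fix g h assume "tc g = tc h"
  then have "merge g h = (fst (merge g h), 0)"
    by (simp add: merge_def)
  then show "two_sided g h \<in> range (\<lambda>k. act (k, 0))"
    using act_merge by (metis rangeI)
qed

lemma iota_parts:
  "zc (left_part (iota q)) + zc (right_part (iota q)) = zc q"
  "pc (left_part (iota q)) = pc q" "qc (left_part (iota q)) = qc q" "tc (left_part (iota q)) = tc q"
  "pc (right_part (iota q)) = 0" "qc (right_part (iota q)) = 0" "tc (right_part (iota q)) = 0"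
  by (cases q; simp add: iota_def left_part_def right_part_def null_defs mat_A_def field_simps)+

lemma act_iota: "act (iota q) = left_translation q"
proof -
  have "act (iota q) = two_sided q \<one>\<^bsub>Q\<^esub>"
    unfolding act_def by (rule two_sided_cong) (simp_all only: iota_parts null_one add_0_right)
  then show ?thesis
    by (auto simp: two_sided_def left_translation_def)
qed

text \<open>The parameters of a two-sided translation from its values \<open>a\<close>, \<open>b\<close>, \<open>c\<close> at the origin and at
  the unit points of the \<open>p\<close>- and \<open>t\<close>-axes. The difference \<open>b - a\<close> shows the scaling of the plane,
  hence the \<open>t\<close>-component of the left factor. Between the origin and time 1 the contribution of
  the left plane component is constant while that of the right one is multiplied by \<open>exp 1\<close> or
  \<open>exp (- 1)\<close>, which separates the two.\<close>

definition recover :: "osc \<Rightarrow> osc \<Rightarrow> osc \<Rightarrow> osc2r" where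
  "recover a b c =
    (let t = tc a; s = ln (pc b - pc a);
         qh = (pc c - pc a) * exp (- t) / (1 - exp 1); pg = pc a + exp t * qh;
         ph = (qc c - qc a) * exp t / (1 - exp (- 1)); qg = qc a + exp (- t) * ph;
         z = zc a + (pg * exp (- t) * ph - qg * exp t * qh) / 4
     in merge (of_null z pg qg s) (of_null 0 ph qh (t - s)))"

lemma recover_act: "recover (act k 0) (act k (of_null 0 1 0 0)) (act k (of_null 0 0 0 1)) = k"
proof -
  define g h where "g = left_part k" and "h = right_part k"
  let ?a = "act k 0" and ?b = "act k (of_null 0 1 0 0)" and ?c = "act k (of_null 0 0 0 1)"
  have nz: "1 - exp (1 :: real) \<noteq> 0" "1 - exp (- 1 :: real) \<noteq> 0"
    by simp_all
  have eq: "act k = two_sided g h"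
    by (simp add: act_def g_def h_def)
  have t: "tc ?a = tc g + tc h"
    by (simp add: eq two_sided_eq)
  have "pc ?b - pc ?a = exp (tc g)"
    by (simp add: eq two_sided_eq)
  then have s: "ln (pc ?b - pc ?a) = tc g"
    by simp
  have "pc ?c - pc ?a = (1 - exp 1) * (exp (tc g + tc h) * qc h)"
    by (simp add: eq two_sided_eq exp_add algebra_simps)
  then have qh: "(pc ?c - pc ?a) * exp (- (tc g + tc h)) / (1 - exp 1) = qc h"
    using nz(1) by (simp only: exp_minus) simp
  have pg: "pc ?a + exp (tc g + tc h) * qc h = pc g"
    by (simp add: eq two_sided_eq exp_add)
  have "qc ?c - qc ?a = (1 - exp (- 1)) * (exp (- (tc g + tc h)) * pc h)"
    by (simp add: eq two_sided_eq exp_diff exp_minus field_simps exp_add)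
  then have ph: "(qc ?c - qc ?a) * exp (tc g + tc h) / (1 - exp (- 1)) = pc h"
    using nz(2) by (simp only: exp_minus) simp
  have qg: "qc ?a + exp (- (tc g + tc h)) * pc h = qc g"
    by (simp add: eq two_sided_eq exp_diff exp_minus exp_add field_simps)
  have z: "zc ?a + (pc g * exp (- (tc g + tc h)) * pc h - qc g * exp (tc g + tc h) * qc h) / 4
      = zc g + zc h"
    by (simp add: eq two_sided_eq exp_diff exp_minus exp_add field_simps)
  have "recover ?a ?b ?c =
    merge (of_null (zc g + zc h) (pc g) (qc g) (tc g)) (of_null 0 (pc h) (qc h) (tc g + tc h - tc g))"
    unfolding recover_def Let_def t s qh pg ph qg z ..
  also have "\<dots> = merge g h"
    by (simp add: merge_def of_null_def null_defs complex_eq_iff mat_A_def field_simps)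
  finally show ?thesis
    by (simp add: g_def h_def)
qed

lemma inj_act: "inj act"
  by (rule inj_on_inverseI[of _ "\<lambda>f. recover (f 0) (f (of_null 0 1 0 0)) (f (of_null 0 0 0 1))"])
    (rule recover_act)

text \<open>As \<open>act\<close> is injective and maps \<open>iota q\<close> to the left translation by \<open>q\<close>, the homomorphism property
  is the associative law of $Q$.\<close>

lemma iota_mon: "iota \<in> mon Q Osc2_R"
  unfolding mon_def hom_def
proof (safe, simp_all)
  have "act (iota (x \<otimes>\<^bsub>Q\<^esub> y)) = act (iota x \<otimes>\<^bsub>Osc2_R\<^esub> iota y)" for x y
    by (rule ext) (simp add: act_iota act_mult left_translation_def Q.m_assoc)
  then show "iota (x \<otimes>\<^bsub>Q\<^esub> y) = iota x \<otimes>\<^bsub>Osc2_R\<^esub> iota y" for x y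
    using inj_act by (simp add: inj_eq)
  show "inj iota"
    by (rule injI) (metis iota_parts null_eqI)
qed

lemma null_parts:
  "zc (left_part (((z, \<xi>, \<eta>), t), s)) = z" "zc (right_part (((z, \<xi>, \<eta>), t), s)) = z"
  "pc (left_part (((z, \<xi>, \<eta>), t), s)) = (Im \<xi> + Re \<xi>) + (Im \<eta> + Re \<eta>)"
  "qc (left_part (((z, \<xi>, \<eta>), t), s)) = (Im \<xi> - Re \<xi>) - (Im \<eta> - Re \<eta>)"
  "pc (right_part (((z, \<xi>, \<eta>), t), s)) = (Im \<xi> + Re \<xi>) - (Im \<eta> + Re \<eta>)"
  "qc (right_part (((z, \<xi>, \<eta>), t), s)) = (Im \<xi> - Re \<xi>) + (Im \<eta> - Re \<eta>)"
  "tc (left_part (((z, \<xi>, \<eta>), t), s)) = t + s" "tc (right_part (((z, \<xi>, \<eta>), t), s)) = t - s"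
  by (simp_all add: left_part_def right_part_def null_defs mat_A_def)

lemma act_stabilizer: "act (((z, \<xi>, \<eta>), t), s) 0 = 0 \<longleftrightarrow> z = 0 \<and> Re \<xi> = 0 \<and> Re \<eta> = 0 \<and> t = 0"
proof
  assume "act (((z, \<xi>, \<eta>), t), s) 0 = 0"
  then have *: "zc (act (((z, \<xi>, \<eta>), t), s) 0) = 0" "pc (act (((z, \<xi>, \<eta>), t), s) 0) = 0"
    "qc (act (((z, \<xi>, \<eta>), t), s) 0) = 0" "tc (act (((z, \<xi>, \<eta>), t), s) 0) = 0"
    by simp_all
  have t: "t = 0"
    using *(4) by (simp add: act_def two_sided_eq null_parts)
  then have "Re \<xi> = 0 \<and> Re \<eta> = 0"
    using *(2,3) by (simp add: act_def two_sided_eq null_parts exp_minus)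
  then show "z = 0 \<and> Re \<xi> = 0 \<and> Re \<eta> = 0 \<and> t = 0"
    using t *(1) by (simp add: act_def two_sided_eq null_parts exp_minus)
next
  assume "z = 0 \<and> Re \<xi> = 0 \<and> Re \<eta> = 0 \<and> t = 0"
  then show "act (((z, \<xi>, \<eta>), t), s) 0 = 0"
    by (intro null_eqI) (simp_all add: act_def two_sided_eq null_parts exp_minus)
qed

section \<open>Geodesic reflections and transvections\<close>

text \<open>By the classification \<open>f\<close> is a conjugation of $Q$, and its derivative at the origin shows that
  the conjugating element is central. Together with transitivity this says that an isometry is
  determined by its 1-jet at a point.\<close>

lemma isometry_rigid:
  assumes f: "f \<in> isometries" and 0: "f 0 = 0" and D: "\<And>v. D f 0 v = v"
  shows "f = id"
proof -
  note sm = smooth_isometry[OF f]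
  obtain c d a m n where t: "\<And>x. tc (f x) = c * tc x + d"
    and p: "\<And>x. pc (f x) = a (tc x) + m (tc x) * pc x + n (tc x) * qc x"
    by (rule isometry_form[OF f]) blast
  have "tc (D f 0 (of_null 0 0 0 1)) = c"
    by (rule D_line[OF sm bounded_linear_null(4)]) (auto simp: t intro!: derivative_eq_intros)
  then have "c = 1"
    by (simp add: D)
  have "pc (D f 0 (of_null 0 1 0 0)) = m 0"
    by (rule D_line[OF sm bounded_linear_null(2)]) (auto simp: p intro!: derivative_eq_intros)
  then have "m 0 = 1"
    by (simp add: D)
  then have "tc (f (of_null 0 0 0 1)) > tc (f 0)" "pc (f (of_null 0 1 0 0)) > pc (f 0)"
    by (simp_all add: t p \<open>c = 1\<close>)
  from isometry_translations[OF f this]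
  obtain g h where gh: "f = (\<lambda>x. g \<otimes>\<^bsub>Q\<^esub> x \<otimes>\<^bsub>Q\<^esub> h)"
    by blast
  have "g \<otimes>\<^bsub>Q\<^esub> h = \<one>\<^bsub>Q\<^esub>"
    using 0 by (simp add: gh flip: one_Q)
  then have h: "h = inv\<^bsub>Q\<^esub> g"
    using Q.inv_equality[of g h] Q.inv_inv[of h] by simp
  have pf: "pc (f x) = pc g + exp (tc g) * pc x - exp (tc x) * pc g"
    and qf: "qc (f x) = qc g + exp (- tc g) * qc x - exp (- tc x) * qc g" for x
    by (simp_all add: gh h exp_add exp_diff exp_minus field_simps)
  have "pc (D f 0 (of_null 0 0 0 1)) = - pc g"
    by (rule D_line[OF sm bounded_linear_null(2)]) (auto simp: pf intro!: derivative_eq_intros)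
  moreover have "qc (D f 0 (of_null 0 0 0 1)) = qc g"
    by (rule D_line[OF sm bounded_linear_null(3)]) (auto simp: qf intro!: derivative_eq_intros)
  moreover have "pc (D f 0 (of_null 0 1 0 0)) = exp (tc g)"
    by (rule D_line[OF sm bounded_linear_null(2)]) (auto simp: pf intro!: derivative_eq_intros)
  ultimately have g: "pc g = 0" "qc g = 0" "tc g = 0"
    by (simp_all add: D)
  show ?thesis
    by (rule ext, rule null_eqI) (simp_all add: gh h g)
qed

definition reflection :: "osc \<Rightarrow> osc \<Rightarrow> osc" where
  "reflection p x = p \<otimes>\<^bsub>Q\<^esub> inv\<^bsub>Q\<^esub> x \<otimes>\<^bsub>Q\<^esub> p"

lemma reflection_eq:
  "reflection p = left_translation p \<circ> inversion \<circ> left_translation (inv\<^bsub>Q\<^esub> p)"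
  by (rule ext) (simp add: reflection_def left_translation_def inversion_def Q.inv_mult_group Q.m_assoc)

lemma D_left_translation_inverse:
  "D (left_translation p) (left_translation (inv\<^bsub>Q\<^esub> p) x) (D (left_translation (inv\<^bsub>Q\<^esub> p)) x v) = v"
  "D (left_translation (inv\<^bsub>Q\<^esub> p)) (left_translation p x) (D (left_translation p) x v) = v"
proof -
  have "left_translation p \<circ> left_translation (inv\<^bsub>Q\<^esub> p) = (\<lambda>x. x)"
    "left_translation (inv\<^bsub>Q\<^esub> p) \<circ> left_translation p = (\<lambda>x. x)"
    by (auto simp: left_translation_def simp flip: Q.m_assoc)
  moreover note D_compose[OF smooth_isometry[OF left_translation_isometry]
      smooth_isometry[OF left_translation_isometry]]
  ultimately show
    "D (left_translation p) (left_translation (inv\<^bsub>Q\<^esub> p) x) (D (left_translation (inv\<^bsub>Q\<^esub> p)) x v) = v"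
    "D (left_translation (inv\<^bsub>Q\<^esub> p)) (left_translation p x) (D (left_translation p) x v) = v"
    by (metis frechet_derivative_ident)+
qed

text \<open>Conjugation by a left translation reduces this to the inversion at the identity element.\<close>

lemma geodesic_reflection_reflection: "geodesic_reflection p (reflection p)"
proof -
  let ?L = "left_translation p" and ?M = "left_translation (inv\<^bsub>Q\<^esub> p)"
  note sm = smooth_isometry[OF left_translation_isometry] smooth_isometry[OF inversion_isometry]
  have iso: "reflection p \<in> isometries"
    unfolding reflection_eq by (intro isometries_comp left_translation_isometry inversion_isometry)
  have Mp: "?M p = 0"
    by (simp add: left_translation_def one_Q)
  have inv0: "inversion 0 = 0"
    by (rule null_eqI) (simp_all add: inversion_def)
  have "D inversion 0 v = - v" for v
    unfolding frechet_derivative_at[OF has_derivative_inversion, symmetric]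
    by (rule null_eqI) simp_all
  then have "D (reflection p) p v = D ?L 0 (- D ?M p v)" for v
  proof -
    have "D (?L \<circ> inversion) 0 u = D ?L 0 (- u)" for u
      using \<open>\<And>v. D inversion 0 v = - v\<close> by (simp add: D_compose sm inv0)
    moreover have "smooth (?L \<circ> inversion)"
      by (intro smooth_isometry isometries_comp left_translation_isometry inversion_isometry)
    ultimately show ?thesis
      unfolding reflection_eq by (simp add: D_compose sm Mp)
  qed
  moreover have "linear (D ?L 0)"
    using smooth_has_derivative[OF sm(1)] by (rule has_derivative_linear)
  ultimately have "D (reflection p) p = (\<lambda>v. - v)"
    using D_left_translation_inverse(1)[of p p] by (intro ext) (simp add: linear_neg Mp)
  moreover have "reflection p p = p"
    by (simp add: reflection_def)
  ultimately show ?thesis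
    unfolding geodesic_reflection_def
    using iso smooth_has_derivative[OF smooth_isometry[OF iso], of p] by simp
qed

text \<open>Composed with \<open>\<sigma>\<close>, the reflection \<open>reflection p\<close> has the 1-jet of the identity at \<open>p\<close>; the two
  left translations in the proof move this point to the origin.\<close>

lemma geodesic_reflection_iff: "geodesic_reflection p \<sigma> \<longleftrightarrow> \<sigma> = reflection p"
proof
  assume \<sigma>: "geodesic_reflection p \<sigma>"
  let ?L = "left_translation p" and ?M = "left_translation (inv\<^bsub>Q\<^esub> p)" and ?r = "reflection p"
  have iso: "\<sigma> \<in> isometries" "?r \<in> isometries" "?L \<in> isometries" "?M \<in> isometries"
    using \<sigma> geodesic_reflection_reflection left_translation_isometry
    by (auto simp: geodesic_reflection_def)
  have fix_p: "\<sigma> p = p" "?r p = p"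
    using \<sigma> geodesic_reflection_reflection by (auto simp: geodesic_reflection_def)
  have D: "D \<sigma> p v = - v" "D ?r p v = - v" for v
    using \<sigma> geodesic_reflection_reflection[of p] frechet_derivative_at
    unfolding geodesic_reflection_def by metis+
  have L0: "?L 0 = p" and Mp: "?M p = 0"
    by (simp_all add: left_translation_def flip: one_Q)
  define f where "f = ?M \<circ> (?r \<circ> (\<sigma> \<circ> ?L))"
  have "f = id"
  proof (rule isometry_rigid)
    show "f \<in> isometries"
      unfolding f_def by (intro isometries_comp iso)
    show "f 0 = 0"
      by (simp add: f_def L0 Mp fix_p)
    have "D (\<sigma> \<circ> ?L) 0 v = - D ?L 0 v" for v
      by (subst D_compose) (simp_all add: smooth_isometry iso L0 D)
    then have "D (?r \<circ> (\<sigma> \<circ> ?L)) 0 v = D ?L 0 v" for v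
      by (subst D_compose) (simp_all add: smooth_isometry isometries_comp iso L0 fix_p D)
    then show "D f 0 v = v" for v
      using D_left_translation_inverse(2)[of p 0 v] unfolding f_def
      by (subst D_compose) (simp_all add: smooth_isometry isometries_comp iso L0 fix_p)
  qed
  show "\<sigma> = ?r"
  proof
    fix x
    have "?r (\<sigma> x) = x"
    proof -
      have "?M (?r (\<sigma> (?L (?M x)))) = ?M x"
        using fun_cong[OF \<open>f = id\<close>, of "?M x"] by (simp add: f_def)
      then show ?thesis
        by (simp add: left_translation_def flip: Q.m_assoc)
    qed
    then have "?r x = ?r (?r (\<sigma> x))"
      by simp
    also have "\<dots> = \<sigma> x"
      by (simp add: reflection_def Q.inv_mult_group Q.m_assoc) (simp flip: Q.m_assoc)
    finally show "\<sigma> x = ?r x" ..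
  qed
qed (simp add: geodesic_reflection_reflection)

definition transvection_generators :: "(osc \<Rightarrow> osc) set" where
  "transvection_generators = {\<sigma> \<circ> \<tau> | \<sigma> \<tau>.
    (\<exists>p. geodesic_reflection p \<sigma>) \<and> (\<exists>q. geodesic_reflection q \<tau>)}"

lemma transvection_generators_eq: "transvection_generators = {reflection p \<circ> reflection q | p q. True}"
  unfolding transvection_generators_def geodesic_reflection_iff by blast

lemma reflection_comp_reflection:
  "reflection p \<circ> reflection q = two_sided (p \<otimes>\<^bsub>Q\<^esub> inv\<^bsub>Q\<^esub> q) (flip (inv\<^bsub>Q\<^esub> q \<otimes>\<^bsub>Q\<^esub> p))"
  by (rule ext) (simp add: reflection_def two_sided_def Q.inv_mult_group Q.m_assoc)

lemma square_transvection: "two_sided p (flip p) \<in> transvection_generators"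
proof -
  have "two_sided p (flip p) = reflection p \<circ> reflection \<one>\<^bsub>Q\<^esub>"
    using reflection_comp_reflection[of p "\<one>\<^bsub>Q\<^esub>"] by simp
  then show ?thesis
    unfolding transvection_generators_eq by blast
qed

text \<open>Write \<open>S a\<close> for the map \<open>x \<mapsto> a x a\<close>. Conjugating \<open>S a\<close> by \<open>S \<tau>\<close>, where \<open>\<tau>\<close> is a translation
  in \<open>t\<close>, multiplies the plane component of the left factor by $e^{A}$ and that of the right factor
  by $e^{-A}$. The product with another \<open>S b\<close> therefore reaches every pair of plane components:
  \<open>a\<close> and \<open>b\<close> solve a linear system with determinant \<open>exp 1 - exp (- 1)\<close>. The factors \<open>S \<theta>\<close> and
  \<open>S w\<close> adjust the \<open>t\<close>-component and the centre.\<close>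

lemma balanced_two_sided_generated:
  assumes "tc g = tc h"
  shows "two_sided g h \<in> generate Isom transvection_generators"
proof -
  define S where "S a = two_sided a (flip a)" for a
  define e :: real where "e = exp 1 - exp (- 1)"
  have e: "e \<noteq> 0"
    by (simp add: e_def)
  define T where "T = tc g"
  define P where "P = (pc g + qc h) / e"
  define R where "R = - (pc h + qc g) / e"
  define a where "a = of_null 0 P R 0"
  define b where "b = of_null 0 (pc g - exp 1 * P) (qc g - exp (- 1) * R) 0"
  define \<tau> where "\<tau> = of_null 0 0 0 1"
  define \<theta> where "\<theta> = of_null 0 0 0 T"
  define l where "l = \<tau> \<otimes>\<^bsub>Q\<^esub> a \<otimes>\<^bsub>Q\<^esub> inv\<^bsub>Q\<^esub> \<tau> \<otimes>\<^bsub>Q\<^esub> b \<otimes>\<^bsub>Q\<^esub> \<theta>"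
  define r where "r = \<theta> \<otimes>\<^bsub>Q\<^esub> b \<otimes>\<^bsub>Q\<^esub> inv\<^bsub>Q\<^esub> \<tau> \<otimes>\<^bsub>Q\<^esub> a \<otimes>\<^bsub>Q\<^esub> \<tau>"
  define w where "w = of_null ((zc g + zc h - zc l - zc r) / 2) 0 0 0"
  have gen: "f \<circ> k \<in> generate Isom transvection_generators"
    if "f \<in> generate Isom transvection_generators" "k \<in> generate Isom transvection_generators" for f k
    using generate.eng[OF that] by simp
  have S: "S a \<in> generate Isom transvection_generators" for a
    unfolding S_def by (intro generate.incl square_transvection)
  have "two_sided g h = two_sided (w \<otimes>\<^bsub>Q\<^esub> l) (flip (r \<otimes>\<^bsub>Q\<^esub> w))"
  proof (rule two_sided_cong)
    have Pe: "exp (- 1) * P = exp 1 * P - (pc g + qc h)"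
      using e by (simp add: P_def e_def field_simps)
    have Re: "exp 1 * R = exp (- 1) * R - (pc h + qc g)"
      using e by (simp add: R_def e_def field_simps)
    show "pc g = pc (w \<otimes>\<^bsub>Q\<^esub> l)" "qc g = qc (w \<otimes>\<^bsub>Q\<^esub> l)" "tc g = tc (w \<otimes>\<^bsub>Q\<^esub> l)"
      by (simp_all add: w_def l_def a_def b_def \<tau>_def \<theta>_def T_def)
    show "tc h = tc (flip (r \<otimes>\<^bsub>Q\<^esub> w))"
      using assms by (simp add: w_def r_def a_def b_def \<tau>_def \<theta>_def T_def)
    show "pc h = pc (flip (r \<otimes>\<^bsub>Q\<^esub> w))" "qc h = qc (flip (r \<otimes>\<^bsub>Q\<^esub> w))"
    proof -
      have r: "pc r = exp T * (pc g - exp 1 * P + exp (- 1) * P)"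
        "qc r = exp (- T) * (qc g - exp (- 1) * R + exp 1 * R)" "tc r = T"
        by (simp_all add: r_def a_def b_def \<tau>_def \<theta>_def exp_diff exp_minus exp_add field_simps)
      have cancel: "exp T * (exp (- T) * y) = y" "exp (- T) * (exp T * y) = y" for y
        by (simp_all flip: mult.assoc exp_add)
      show "pc h = pc (flip (r \<otimes>\<^bsub>Q\<^esub> w))" "qc h = qc (flip (r \<otimes>\<^bsub>Q\<^esub> w))"
        using Pe Re by (simp_all add: w_def r cancel)
    qed
    show "zc g + zc h = zc (w \<otimes>\<^bsub>Q\<^esub> l) + zc (flip (r \<otimes>\<^bsub>Q\<^esub> w))"
      by (simp add: w_def)
  qed
  also have "\<dots> = S w \<circ> (S \<tau> \<circ> (S a \<circ> (S (inv\<^bsub>Q\<^esub> \<tau>) \<circ> (S b \<circ> S \<theta>))))"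
    by (rule ext) (simp add: S_def two_sided_def l_def r_def Q.m_assoc)
  finally show ?thesis
    by (simp only:) (intro gen S)
qed

lemma carrier_Transv: "carrier Transv = range (\<lambda>k. act (k, 0))"
proof -
  have "generate Isom transvection_generators = {two_sided g h | g h. tc g = tc h}" (is "?G = ?B")
  proof
    have gens: "transvection_generators \<subseteq> ?B"
      unfolding transvection_generators_eq reflection_comp_reflection by fastforce
    have "subgroup ?B Isom"
    proof (rule Isom.subgroupI)
      show "?B \<subseteq> carrier Isom"
        using two_sided_isometry by auto
      show "?B \<noteq> {}"
        by blast
    next
      fix f assume "f \<in> ?B"
      then obtain g h where f: "f = two_sided g h" "tc g = tc h"
        by blast
      have "inv\<^bsub>Isom\<^esub> f = two_sided (inv\<^bsub>Q\<^esub> g) (inv\<^bsub>Q\<^esub> h)"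
        by (rule Isom.inv_equality)
          (simp_all add: f two_sided_isometry two_sided_one flip: two_sided_mult)
      then show "inv\<^bsub>Isom\<^esub> f \<in> ?B"
      proof -
        have "tc (inv\<^bsub>Q\<^esub> g) = tc (inv\<^bsub>Q\<^esub> h)"
          using f(2) by simp
        then show ?thesis
          using \<open>inv\<^bsub>Isom\<^esub> f = _\<close> by blast
      qed
    next
      fix f k assume "f \<in> ?B" "k \<in> ?B"
      then obtain g h g' h' where "f = two_sided g h" "tc g = tc h" "k = two_sided g' h'" "tc g' = tc h'"
        by blast
      then have "f \<otimes>\<^bsub>Isom\<^esub> k = two_sided (g \<otimes>\<^bsub>Q\<^esub> g') (h \<otimes>\<^bsub>Q\<^esub> h')"
        "tc (g \<otimes>\<^bsub>Q\<^esub> g') = tc (h \<otimes>\<^bsub>Q\<^esub> h')"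
        by (simp_all add: two_sided_mult)
      then show "f \<otimes>\<^bsub>Isom\<^esub> k \<in> ?B"
        by blast
    qed
    then show "?G \<subseteq> ?B"
      by (rule Isom.generate_subgroup_incl[OF gens])
    show "?B \<subseteq> ?G"
      using balanced_two_sided_generated by blast
  qed
  then show ?thesis
    unfolding range_act_Osc2 Transv_def transvection_generators_def by simp
qed

section \<open>The compact-open topology\<close>

lemma topspace_compact_open [simp]:
  "topspace (compact_open :: ('a::topological_space \<Rightarrow> 'b::topological_space) topology) = UNIV"
proof -
  have "(UNIV :: ('a \<Rightarrow> 'b) set) \<in> {{f. f ` K \<subseteq> U} | K U. compact K \<and> open U}"
    by (intro CollectI exI[of _ "{}"]) auto
  then show ?thesis
    unfolding compact_open_def topology_generated_by_topspace by blast
qed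

text \<open>A jointly continuous family of maps is continuous for the compact-open topology, by the tube
  lemma.\<close>

lemma continuous_map_compact_open:
  fixes F :: "'a::topological_space \<Rightarrow> 'b::topological_space \<Rightarrow> 'c::topological_space"
  assumes F: "continuous_on UNIV (\<lambda>w. F (fst w) (snd w))"
  shows "continuous_map euclidean compact_open F"
  unfolding compact_open_def
proof (rule continuous_on_generated_topo)
  fix W assume "W \<in> {{f :: 'b \<Rightarrow> 'c. f ` K \<subseteq> U} | K U. compact K \<and> open U}"
  then obtain K U where W: "W = {f. f ` K \<subseteq> U}" and "compact K" "open U"
    by blast
  have "open ((\<lambda>w. F (fst w) (snd w)) -` U)"
    using F \<open>open U\<close> by (simp add: continuous_on_open_vimage[OF open_UNIV])
  have nbhd: "\<exists>T. open T \<and> k \<in> T \<and> T \<subseteq> F -` W" if "k \<in> F -` W" for k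
  proof -
    have "{k} \<times> K \<subseteq> (\<lambda>w. F (fst w) (snd w)) -` U"
      using that by (auto simp: W)
    from Elementary_Topology.tube_lemma[OF \<open>compact K\<close> \<open>open (_ -` U)\<close> this]
    obtain T where "k \<in> T" "open T" "T \<times> K \<subseteq> (\<lambda>w. F (fst w) (snd w)) -` U"
      by blast
    then show ?thesis
      by (intro exI[of _ T]) (auto simp: W)
  qed
  have "open (F -` W)"
    unfolding open_subopen[of "F -` W"] using nbhd by blast
  then show "openin euclidean (F -` W \<inter> topspace euclidean)"
    by simp
next
  show "F ` topspace euclidean \<subseteq> \<Union> {{f. f ` K \<subseteq> U} | K U. compact K \<and> open U}"
    using topspace_compact_open[where 'a = 'b and 'b = 'c]
    unfolding compact_open_def topology_generated_by_topspace by blast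
qed

lemma continuous_map_evaluation:
  fixes x :: "'a::topological_space"
  shows "continuous_map compact_open euclidean (\<lambda>f :: 'a \<Rightarrow> 'b::topological_space. f x)"
  unfolding continuous_map_def
proof (intro conjI allI impI)
  fix U :: "'b set" assume "openin euclidean U"
  then have "{f. f ` {x} \<subseteq> U} \<in> {{f. f ` K \<subseteq> U} | K U. compact K \<and> open U}"
    by (intro CollectI exI[of _ "{x}"] exI[of _ U]) simp
  then have "openin compact_open {f. f ` {x} \<subseteq> U}"
    unfolding compact_open_def by (rule topology_generated_by_Basis)
  then show "openin compact_open {f \<in> topspace compact_open. f x \<in> U}"
    by simp
qed simp

section \<open>The topology of the isometry group\<close>

lemma continuous_on_null [continuous_intros]:
  assumes "continuous_on S f"
  shows "continuous_on S (\<lambda>x. zc (f x))" "continuous_on S (\<lambda>x. pc (f x))"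
    "continuous_on S (\<lambda>x. qc (f x))" "continuous_on S (\<lambda>x. tc (f x))"
  using bounded_linear_null[THEN bounded_linear.continuous_on[OF _ assms]] by blast+

lemma continuous_on_of_null [continuous_intros]:
  assumes "continuous_on S z" "continuous_on S p" "continuous_on S q" "continuous_on S t"
  shows "continuous_on S (\<lambda>x. of_null (z x) (p x) (q x) (t x))"
  by (subst of_null_eq) (intro continuous_intros assms)

lemma bounded_linear_mat_A: "bounded_linear mat_A"
  by (rule linear_linear[THEN iffD2]) (auto intro!: linearI simp: mat_A_def complex_eq_iff)

lemmas continuous_on_mat_A [continuous_intros] = bounded_linear.continuous_on[OF bounded_linear_mat_A]

lemma continuous_on_parts [continuous_intros]:
  assumes "continuous_on S f"
  shows "continuous_on S (\<lambda>x. left_part (f x))" "continuous_on S (\<lambda>x. right_part (f x))"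
  unfolding left_part_def right_part_def by (intro continuous_intros assms)+

lemma continuous_on_merge [continuous_intros]:
  assumes "continuous_on S f" "continuous_on S g"
  shows "continuous_on S (\<lambda>x. merge (f x) (g x))"
  unfolding merge_def by (intro continuous_intros assms) simp_all

lemma continuous_map_act: "continuous_map euclidean compact_open act"
proof (rule continuous_map_compact_open)
  show "continuous_on UNIV (\<lambda>w. act (fst w) (snd w))"
    unfolding act_def two_sided_eq
    by (intro continuous_on_of_null continuous_on_add continuous_on_diff continuous_on_mult
        continuous_on_minus continuous_on_divide continuous_on_exp continuous_on_null continuous_on_parts
        continuous_on_fst continuous_on_snd continuous_on_id continuous_on_const) simp_all
qed

lemma continuous_on_recover:
  "continuous_on {x. pc (fst (snd x)) > pc (fst x)} (\<lambda>x. recover (fst x) (fst (snd x)) (snd (snd x)))"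
  unfolding recover_def Let_def by (intro continuous_intros) auto

lemma act_positive:
  "tc (act k (of_null 0 0 0 1)) > tc (act k 0)" "pc (act k (of_null 0 1 0 0)) > pc (act k 0)"
  by (simp_all add: act_def two_sided_eq)

lemma range_act_iff:
  "f \<in> range act \<longleftrightarrow> f \<in> isometries \<and>
    tc (f (of_null 0 0 0 1)) > tc (f 0) \<and> pc (f (of_null 0 1 0 0)) > pc (f 0)"
proof
  assume "f \<in> range act"
  then show "f \<in> isometries \<and>
    tc (f (of_null 0 0 0 1)) > tc (f 0) \<and> pc (f (of_null 0 1 0 0)) > pc (f 0)"
    using act_positive two_sided_isometry unfolding act_def by blast
next
  assume "f \<in> isometries \<and>
    tc (f (of_null 0 0 0 1)) > tc (f 0) \<and> pc (f (of_null 0 1 0 0)) > pc (f 0)"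
  then obtain g h where "f = (\<lambda>x. g \<otimes>\<^bsub>Q\<^esub> x \<otimes>\<^bsub>Q\<^esub> h)"
    using isometry_translations by blast
  then have "f = two_sided g (flip h)"
    by (simp add: two_sided_def fun_eq_iff)
  then show "f \<in> range act"
    unfolding range_act by blast
qed

abbreviation isom_top :: "(osc \<Rightarrow> osc) topology" where
  "isom_top \<equiv> subtopology compact_open isometries"

lemma openin_evaluations:
  fixes h :: "osc \<Rightarrow> osc \<Rightarrow> real"
  assumes "continuous_on UNIV (\<lambda>w. h (fst w) (snd w))" "open U"
  shows "openin isom_top {f \<in> isometries. h (f x) (f y) \<in> U}"
proof -
  have "continuous_map isom_top (prod_topology euclidean euclidean) (\<lambda>f. (f x, f y))"
    by (intro continuous_map_pairedI continuous_map_from_subtopology continuous_map_evaluation)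
  then have "continuous_map isom_top euclidean ((\<lambda>w. h (fst w) (snd w)) \<circ> (\<lambda>f. (f x, f y)))"
    using assms(1) by (intro continuous_map_compose[of _ euclidean]) (simp_all add: prod_topology_euclidean)
  then show ?thesis
    using openin_continuous_map_preimage[of isom_top euclidean "(\<lambda>w. h (fst w) (snd w)) \<circ> (\<lambda>f. (f x, f y))" U] assms(2)
    by simp
qed

text \<open>The range of \<open>act\<close> is connected as a continuous image of a vector space, and it is both open and
  closed among the isometries.\<close>

lemma identity_component: "connected_component_of_set isom_top id = range act"
proof
  have id: "id \<in> range act"
    unfolding range_act two_sided_one[symmetric] by blast
  have "connectedin isom_top (act ` UNIV)"
  proof (rule connectedin_continuous_map_image)
    show "continuous_map euclidean isom_top act"
      using continuous_map_act range_act_iff by (auto simp: continuous_map_in_subtopology)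
    show "connectedin euclidean (UNIV :: osc2r set)"
      by (simp add: connected_UNIV)
  qed
  then show "range act \<subseteq> connected_component_of_set isom_top id"
    using id by (intro connected_component_of_maximal)
  let ?t = "\<lambda>f :: osc \<Rightarrow> osc. tc (f (of_null 0 0 0 1)) - tc (f 0)"
  let ?p = "\<lambda>f :: osc \<Rightarrow> osc. pc (f (of_null 0 1 0 0)) - pc (f 0)"
  let ?q = "\<lambda>f :: osc \<Rightarrow> osc. pc (f (of_null 0 0 1 0)) - pc (f 0)"
  have ct: "continuous_on UNIV (\<lambda>w :: osc \<times> osc. tc (fst w) - tc (snd w))"
    and cp: "continuous_on UNIV (\<lambda>w :: osc \<times> osc. pc (fst w) - pc (snd w))"
    by (intro continuous_intros)+
  have "range act = {f \<in> isometries. ?t f \<in> {0<..}} \<inter> {f \<in> isometries. ?p f \<in> {0<..}}"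
    using range_act_iff by auto
  then have op: "openin isom_top (range act)"
    using openin_evaluations[of "\<lambda>a b. tc a - tc b" "{0<..}" "of_null 0 0 0 1" 0, OF ct]
      openin_evaluations[of "\<lambda>a b. pc a - pc b" "{0<..}" "of_null 0 1 0 0" 0, OF cp] by auto
  \<comment> \<open>The complement is open as well: exactly one of \<open>?p f\<close> and \<open>?q f\<close> is nonzero, so the condition
    \<open>?p f = 0\<close> can be replaced by \<open>?q f \<noteq> 0\<close>.\<close>
  have "isometries - range act = {f \<in> isometries. ?t f \<in> {..<0}} \<union>
    ({f \<in> isometries. ?p f \<in> {..<0}} \<union> {f \<in> isometries. ?q f \<in> - {0}})" (is "?A = ?B")
  proof -
    have "f \<notin> range act \<longleftrightarrow> ?t f < 0 \<or> ?p f < 0 \<or> ?q f \<noteq> 0" if f: "f \<in> isometries" for f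
    proof -
      obtain c d a m n m' n' where c: "c\<^sup>2 = 1"
        and t: "\<And>x. tc (f x) = c * tc x + d"
        and p: "\<And>x. pc (f x) = a (tc x) + m (tc x) * pc x + n (tc x) * qc x"
        and o: "\<And>s :: real. m s * m' s = 0" "\<And>s. n s * n' s = 0" "\<And>s. m s * n' s + n s * m' s = 1"
        by (rule isometry_form[OF f]) blast
      have "?t f = c" "?p f = m 0" "?q f = n 0"
        by (simp_all add: t p)
      moreover have "c = 1 \<or> c = -1"
        using c by (simp add: power2_eq_1_iff)
      moreover have "(m 0 = 0) \<noteq> (n 0 = 0)"
        using o[of 0] by auto
      ultimately show ?thesis
        using range_act_iff[of f] f by auto
    qed
    then show ?thesis
      by auto
  qed
  then have "openin isom_top (isometries - range act)"
    using openin_evaluations[of "\<lambda>a b. tc a - tc b" "{..<0}" "of_null 0 0 0 1" 0, OF ct]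
      openin_evaluations[of "\<lambda>a b. pc a - pc b" "{..<0}" "of_null 0 1 0 0" 0, OF cp]
      openin_evaluations[of "\<lambda>a b. pc a - pc b" "- {0}" "of_null 0 0 1 0" 0, OF cp] by auto
  then have "closedin isom_top (range act)"
    using openin_subset[OF op] by (simp add: closedin_def)
  then have "connected_component_of_set isom_top id \<subseteq> range act \<or>
      disjnt (connected_component_of_set isom_top id) (range act)"
    using connectedin_clopen_cases[OF connectedin_connected_component_of _ op] by blast
  moreover have "id \<in> connected_component_of_set isom_top id"
    using id_isometry by (simp add: connected_component_of_refl)
  ultimately show "connected_component_of_set isom_top id \<subseteq> range act"
    using id by (auto simp: disjnt_iff)
qed

lemma carrier_Isom_0: "carrier Isom_0 = range act"
  by (simp add: Isom_0_def identity_component)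

lemma homeomorphic_map_act: "homeomorphic_map euclidean (subtopology compact_open (range act)) act"
proof -
  let ?R = "\<lambda>x. recover (fst x) (fst (snd x)) (snd (snd x))"
  let ?E = "\<lambda>f :: osc \<Rightarrow> osc. (f 0, f (of_null 0 1 0 0), f (of_null 0 0 0 1))"
  let ?S = "{x :: osc \<times> osc \<times> osc. pc (fst (snd x)) > pc (fst x)}"
  have "continuous_map (subtopology compact_open (range act))
      (prod_topology euclidean (prod_topology euclidean euclidean)) ?E"
    by (intro continuous_map_pairedI continuous_map_from_subtopology continuous_map_evaluation)
  then have "continuous_map (subtopology compact_open (range act)) (top_of_set ?S) ?E"
    using act_positive(2) by (auto simp: continuous_map_in_subtopology prod_topology_euclidean)
  moreover have "continuous_map (top_of_set ?S) euclidean ?R"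
    using continuous_on_recover by simp
  ultimately have "continuous_map (subtopology compact_open (range act)) euclidean (?R \<circ> ?E)"
    by (rule continuous_map_compose)
  moreover have "continuous_map euclidean (subtopology compact_open (range act)) act"
    using continuous_map_act by (simp add: continuous_map_in_subtopology)
  ultimately have "homeomorphic_maps euclidean (subtopology compact_open (range act)) act (?R \<circ> ?E)"
    unfolding homeomorphic_maps_def using recover_act by auto
  then show ?thesis
    using homeomorphic_map_maps by blast
qed

lemma homeomorphic_map_act_Osc2:
  "homeomorphic_map euclidean (subtopology compact_open (range (\<lambda>k. act (k, 0)))) (\<lambda>k. act (k, 0))"
proof -
  have "homeomorphic_maps euclidean (top_of_set (range (\<lambda>k :: heis2 \<times> real. (k, 0 :: real)))) (\<lambda>k. (k, 0)) fst"
    by (auto simp: homeomorphic_maps_def continuous_map_in_subtopology intro!: continuous_intros)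
  then have "homeomorphic_map euclidean (top_of_set (range (\<lambda>k :: heis2 \<times> real. (k, 0 :: real)))) (\<lambda>k. (k, 0))"
    using homeomorphic_map_maps by blast
  moreover have "homeomorphic_map (top_of_set (range (\<lambda>k :: heis2 \<times> real. (k, 0 :: real))))
      (subtopology (subtopology compact_open (range act)) (act ` range (\<lambda>k. (k, 0)))) act"
    by (rule homeomorphic_map_subtopologies[OF homeomorphic_map_act]) auto
  ultimately have "homeomorphic_map euclidean
      (subtopology (subtopology compact_open (range act)) (act ` range (\<lambda>k. (k, 0)))) (act \<circ> (\<lambda>k. (k, 0)))"
    by (rule homeomorphic_map_compose)
  moreover have "range act \<inter> act ` range (\<lambda>k. (k, 0)) = range (\<lambda>k. act (k, 0))"
    by auto
  ultimately show ?thesis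
    by (simp add: subtopology_subtopology comp_def)
qed

lemma Osc2_R_mult: "(k, 0) \<otimes>\<^bsub>Osc2_R\<^esub> (l, 0) = (k \<otimes>\<^bsub>Osc2\<^esub> l, 0)"
  by (cases l) (auto simp: Osc2_R_def semidirect_real_def s_action_def exp_sphi_eq)

theorem proposition10p1:
  shows "\<exists>\<Phi>_hat \<Phi>.
    \<Phi>_hat \<in> lie_iso Osc2 Transv \<and>
    \<Phi> \<in> lie_iso Osc2_R Isom_0 \<and>
    (\<forall>h. \<Phi> (h, 0) = \<Phi>_hat h) \<and>
    stabilizer Transv (\<lambda>f. f) \<one>\<^bsub>Q\<^esub> = \<Phi>_hat ` G_hat_plus \<and>
    stabilizer Isom_0 (\<lambda>f. f) \<one>\<^bsub>Q\<^esub> = \<Phi> ` (G_hat_plus \<times> UNIV) \<and>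
    iota \<in> mon Q Osc2_R \<and>
    \<Phi> ` range iota = range left_translation"
proof (intro exI conjI)
  let ?act_hat = "\<lambda>k. act (k, 0)"
  have mult: "f \<otimes>\<^bsub>Transv\<^esub> g = f \<circ> g" "f \<otimes>\<^bsub>Isom_0\<^esub> g = f \<circ> g" for f g
    by (simp_all add: Transv_def Isom_0_def Isom_def)
  have "inj ?act_hat"
    using inj_act by (auto simp: inj_def)
  then show "?act_hat \<in> lie_iso Osc2 Transv"
    using homeomorphic_map_act_Osc2
    by (auto simp: lie_iso_def iso_def hom_def bij_betw_def carrier_Transv mult simp flip: act_mult Osc2_R_mult)
  show "act \<in> lie_iso Osc2_R Isom_0"
    using homeomorphic_map_act inj_act
    by (auto simp: lie_iso_def iso_def hom_def bij_betw_def carrier_Isom_0 mult act_mult)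
  show "\<forall>h. act (h, 0) = ?act_hat h"
    by simp
  have G: "(((z, \<xi>, \<eta>), t)) \<in> G_hat_plus \<longleftrightarrow> z = 0 \<and> Re \<xi> = 0 \<and> Re \<eta> = 0 \<and> t = 0" for z \<xi> \<eta> t
    by (auto simp: G_hat_plus_def complex_eq_iff)
  have st: "act (k, s) 0 = 0 \<longleftrightarrow> k \<in> G_hat_plus" for k s
    by (cases k) (auto simp: G act_stabilizer)
  show "stabilizer Transv (\<lambda>f. f) \<one>\<^bsub>Q\<^esub> = ?act_hat ` G_hat_plus"
    unfolding stabilizer_def carrier_Transv one_Q using st by blast
  show "stabilizer Isom_0 (\<lambda>f. f) \<one>\<^bsub>Q\<^esub> = act ` (G_hat_plus \<times> UNIV)"
  proof -
    have "k \<in> G_hat_plus \<times> UNIV \<longleftrightarrow> act k 0 = 0" for k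
      using st by (cases k) auto
    then show ?thesis
      unfolding stabilizer_def carrier_Isom_0 one_Q by blast
  qed
  show "iota \<in> mon Q Osc2_R"
    by (rule iota_mon)
  show "act ` range iota = range left_translation"
    by (simp add: image_image act_iota)
qed

end
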